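(* Let $\mathbb{K}=\mathbb{R}$ or $\mathbb{C}$ and let $I=\langle h_1,\ldots,h_m\rangle\subseteq\mathbb{K}[x]$. Let $t\ge d$, $1\le s\le t$, let $y\in K_t^{\mathbb{K}}$ be such that $\operatorname{rank} M_t^{\mathbb{K}}(y)$ is maximum over $K_t^{\mathbb{K}}$, and let $\mathcal{B}\subseteq\mathbb{T}_{n,s-1}$ index a maximum nonsingular principal submatrix of $M^{\mathbb{K}}_{s-1}(y)$, with border $\partial\mathcal{B}$. Assume: (i) $\mathcal{B}$ is an order ideal. (ii) The principal submatrix of $M_s^{\mathbb{K}}(y)$ indexed by $\mathcal{B}\cup\partial\mathcal{B}$ has the same rank as $M_{s-1}^{\mathbb{K}}(y)$; that is, with $\mathcal{B}=\{b_1,\ldots,b_N\}$ and $\partial\mathcal{B}=\{c_1,\ldots,c_H\}$, for each $j$ there exists a polynomial $g_j\in\operatorname{Ker} M_s^{\mathbb{K}}(y)$ of the form $g_j=c_j-\sum_{i=1}^N a_{ij}b_i$ with $a_{ij}\in\mathbb{K}$ (i.e. $G:=\{g_1,\ldots,g_H\}$ is a $\mathcal{B}$-border prebasis). (iii) The formal multiplication matrices $\mathcal{X}_1,\ldots,\mathcal{X}_n$ defined from $G$ commute pairwise. Then $G$ is a ($\mathcal{B}$-)border basis of $J:=\langle G\rangle\subseteq I(V_{\mathbb{K}}(I))$, $\mathcal{B}$ is a linear basis of $\mathbb{K}[x]/J$, and the set $W:=V_{\mathbb{C}}(J)$ (which can be extracted from the formal multiplication matrices) satisfies $V_{\mathbb{K}}(I)\subseteq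 W$ and $|W|\le\operatorname{rank} M_{s-1}^{\mathbb{K}}(y)$. Moreover, if $|V_{\mathbb{K}}(I)|=|W|=\operatorname{rank} M_{s-1}^{\mathbb{K}}(y)$, then $V_{\mathbb{K}}(I)=W$, $I(V_{\mathbb{K}}(I))=J$, and $G$ is a $\mathcal{B}$-border basis of $I(V_{\mathbb{K}}(I))$.
   Context: $\mathbb{K}[x]=\mathbb{K}[x_1,\ldots,x_n]$; $V_{\mathbb{C}}(I)$ is the complex zero set of $I$, $V_{\mathbb{R}}(I)=V_{\mathbb{C}}(I)\cap\mathbb{R}^n$; $I(V)$ is the ideal of polynomials in $\mathbb{K}[x]$ vanishing on $V$; $\langle A\rangle$ is the ideal generated by $A$. $|\alpha|=\sum_i\alpha_i$; $\mathbb{N}^n_t=\{\alpha\in\mathbb{N}^n:|\alpha|\le t\}$; $\mathbb{T}_n$ is the set of monomials $x^\alpha$ and $\mathbb{T}_{n,t}=\{x^\alpha:|\alpha|\le t\}$. $d_j:=\lceil\deg(h_j)/2\rceil$, $d:=\max_j d_j$. Border bases. An order ideal is a set $\mathcal{B}\subseteq\mathbb{T}_n$ closed under taking divisors. Its border is $\partial\mathcal{B}=\{x_ib : b\in\mathcal{B},\ 1\le i\le n\}\setminus\mathcal{B}$. A $\mathcal{B}$-border prebasis is a set $G=\{g_1,\ldots,g_H\}$ with $g_j=c_j-\sum_i a_{ij}b_i$ as in (ii). It is a $\mathcal{B}$-border basis of an ideal $J\supseteq G$ if $\mathcal{B}$ is linearly independent in $\mathbb{K}[x]/J$ (equivalently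 a linear basis of $\mathbb{K}[x]/J$). For $k\in\{1,\ldots,n\}$ the formal multiplication matrix $\mathcal{X}_k$ is the $N\times N$ matrix whose $i$th column is the unit vector $e_r$ if $x_kb_i=b_r\in\mathcal{B}$, and is $(a_{lj})_{l=1}^N$ if $x_kb_i=c_j\in\partial\mathcal{B}$. Real case ($\mathbb{K}=\mathbb{R}$). For $y\in\mathbb{R}^{\mathbb{N}^n_{2t}}$ and $s\le t$, $M_s^{\mathbb{R}}(y)$ is indexed by $\mathbb{T}_{n,s}$ (equivalently $\mathbb{N}^n_s$) with $(\alpha,\beta)$ entry $y_{\alpha+\beta}$; $(hy)_\alpha=\sum_\beta h_\beta y_{\alpha+\beta}$ for $h=\sum_\beta h_\beta x^\beta$; and $K_t^{\mathbb{R}}=\{y\in\mathbb{R}^{\mathbb{N}^n_{2t}} : y_0=1,\ M_t^{\mathbb{R}}(y)\succeq0,\ M_{t-d_j}^{\mathbb{R}}(h_jy)=0\ (j=1,\ldots,m)\}$. Complex case ($\mathbb{K}=\mathbb{C}$). Here $y=(y_{\alpha\alpha'})\in\mathbb{C}^{\mathbb{N}^{2n}_{2t}}$, indexed by pairs $(\alpha,\alpha')\in\mathbb{N}^n\times\mathbb{N}^n$ with $|\alpha|+|\alpha'|\le 2t$. $M_s^{\mathbb{C}}(y)$ is indexed by $\mathbb{T}_{n,s}$ (equivalently $\mathbb{N}^n_s$) with $(\alpha',\beta')$ entry $y_{\alpha'\beta'}$. For $h=\sum_{\beta'}h_{\beta'}x^{\beta'}\in\mathbb{C}[x]$, $(hy)_{\alpha\alpha'}=\sum_{\beta'}h_{\beta'}y_{\alpha',\alpha+\beta'}$.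 $K_t^{\mathbb{C}}=\{y\in\mathbb{C}^{\mathbb{N}^{2n}_{2t}} : y_{00}=1,\ y_{\alpha'\alpha}=\overline{y_{\alpha\alpha'}}\ \forall(\alpha,\alpha'),\ M_t^{\mathbb{C}}(y)\succeq0,\ M_{t-d_j}^{\mathbb{C}}(h_jy)=0\ (j=1,\ldots,m)\}$. In both cases, a polynomial $f\in\mathbb{K}[x]$ of degree at most $s$ lies in $\operatorname{Ker} M_s^{\mathbb{K}}(y)$ if its coefficient vector does. *)

theory Defs
  imports
    "HOL-Analysis.Analysis"
    "HOL-Library.Poly_Mapping"
    "HOL-Library.Function_Algebras"
begin

text \<open>
  The \<open>n\<close> variables are indexed by a finite type \<open>'n\<close>. A monomial \<open>x^\<alpha>\<close> is represented by its
  exponent \<open>\<alpha>\<close>, so products of monomials are sums of exponents. A polynomial is a finitely supported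
  map from exponents to coefficients, multiplied by convolution.
\<close>

type_synonym 'n expo = "'n \<Rightarrow>\<^sub>0 nat"
type_synonym ('n, 'k) mpoly = "'n expo \<Rightarrow>\<^sub>0 'k"

definition expo_deg :: "'n::finite expo \<Rightarrow> nat" where
  "expo_deg \<alpha> = (\<Sum>i\<in>UNIV. Poly_Mapping.lookup \<alpha> i)"

definition expos :: "nat \<Rightarrow> 'n::finite expo set" where
  "expos t = {\<alpha>. expo_deg \<alpha> \<le> t}"

text \<open>The total degree; the zero polynomial gets degree \<open>0\<close>.\<close>

definition mdegree :: "('n::finite, 'k::zero) mpoly \<Rightarrow> nat" where
  "mdegree f = Max (insert 0 (expo_deg ` Poly_Mapping.keys f))"

definition half_deg :: "('n::finite, 'k::zero) mpoly \<Rightarrow> nat" where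
  "half_deg f = nat \<lceil>real (mdegree f) / 2\<rceil>"

text \<open>The number \<open>d = max d\<^sub>j\<close> for \<open>h\<^sub>1, \<dots>, h\<^sub>m\<close>; it is \<open>0\<close> if \<open>m = 0\<close>.\<close>

definition max_half_deg :: "(nat \<Rightarrow> ('n::finite, 'k::zero) mpoly) \<Rightarrow> nat \<Rightarrow> nat" where
  "max_half_deg h m = Max (insert 0 ((\<lambda>j. half_deg (h j)) ` {1..m}))"

definition ideal_gen :: "('n, 'k::comm_ring_1) mpoly set \<Rightarrow> ('n, 'k) mpoly set" where
  "ideal_gen A = module.span (*) A"

definition is_ideal :: "('n, 'k::comm_ring_1) mpoly set \<Rightarrow> bool" where
  "is_ideal J \<longleftrightarrow> module.subspace (*) J"

text \<open>
  Polynomials over the coefficient field \<open>'k\<close> are evaluated at complex points through the embedding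
  \<open>\<iota>\<close> of \<open>'k\<close> into the complex numbers; below, \<open>\<iota>\<close> is \<open>complex_of_real\<close> or the identity.
\<close>

definition mpoly_eval :: "('k::zero \<Rightarrow> complex) \<Rightarrow> ('n::finite, 'k) mpoly \<Rightarrow> complex ^ 'n \<Rightarrow> complex" where
  "mpoly_eval \<iota> f v =
     (\<Sum>\<alpha>\<in>Poly_Mapping.keys f. \<iota> (Poly_Mapping.lookup f \<alpha>) * (\<Prod>i\<in>UNIV. (v $ i) ^ Poly_Mapping.lookup \<alpha> i))"

definition complex_variety :: "('k::zero \<Rightarrow> complex) \<Rightarrow> ('n::finite, 'k) mpoly set \<Rightarrow> (complex ^ 'n) set" where
  "complex_variety \<iota> S = {v. \<forall>f\<in>S. mpoly_eval \<iota> f v = 0}"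

definition real_points :: "(complex ^ 'n) set" where
  "real_points = {v. \<forall>i. v $ i \<in> \<real>}"

definition vanishing_ideal :: "('k::zero \<Rightarrow> complex) \<Rightarrow> (complex ^ 'n::finite) set \<Rightarrow> ('n, 'k) mpoly set" where
  "vanishing_ideal \<iota> V = {f. \<forall>v\<in>V. mpoly_eval \<iota> f v = 0}"

text \<open>
  A square matrix is a function of a row index and a column index, together with a finite set \<open>A\<close> of
  indices. The principal submatrix indexed by a subset of \<open>A\<close> is the same function with the smaller
  index set. The rank is the dimension of the column space.
\<close>

definition mat_rank :: "'i set \<Rightarrow> ('i \<Rightarrow> 'i \<Rightarrow> 'k::field) \<Rightarrow> nat" where
  "mat_rank A M =
     vector_space.dim (\<lambda>(c::'k) (v::'i \<Rightarrow> 'k) i. c * v i) ((\<lambda>j i. if i \<in> A then M i j else 0) ` A)"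

definition mat_mult :: "'i set \<Rightarrow> ('i \<Rightarrow> 'i \<Rightarrow> 'k::semiring_0) \<Rightarrow> ('i \<Rightarrow> 'i \<Rightarrow> 'k) \<Rightarrow> 'i \<Rightarrow> 'i \<Rightarrow> 'k" where
  "mat_mult A M N = (\<lambda>i k. \<Sum>j\<in>A. M i j * N j k)"

definition mat_eq :: "'i set \<Rightarrow> ('i \<Rightarrow> 'i \<Rightarrow> 'k) \<Rightarrow> ('i \<Rightarrow> 'i \<Rightarrow> 'k) \<Rightarrow> bool" where
  "mat_eq A M N \<longleftrightarrow> (\<forall>i\<in>A. \<forall>j\<in>A. M i j = N i j)"

definition nonsingular :: "'i set \<Rightarrow> ('i \<Rightarrow> 'i \<Rightarrow> 'k::field) \<Rightarrow> bool" where
  "nonsingular A M \<longleftrightarrow>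
     (\<exists>N. mat_eq A (mat_mult A M N) (\<lambda>i j. if i = j then 1 else 0) \<and>
          mat_eq A (mat_mult A N M) (\<lambda>i j. if i = j then 1 else 0))"

text \<open>Maximum refers to the size of the submatrix.\<close>

definition max_nonsingular_principal :: "'i set \<Rightarrow> ('i \<Rightarrow> 'i \<Rightarrow> 'k::field) \<Rightarrow> 'i set \<Rightarrow> bool" where
  "max_nonsingular_principal A M B \<longleftrightarrow>
     B \<subseteq> A \<and> nonsingular B M \<and> (\<forall>B'. B' \<subseteq> A \<and> nonsingular B' M \<longrightarrow> card B' \<le> card B)"

definition psd_real :: "'i set \<Rightarrow> ('i \<Rightarrow> 'i \<Rightarrow> real) \<Rightarrow> bool" where
  "psd_real A M \<longleftrightarrow>
     (\<forall>i\<in>A. \<forall>j\<in>A. M j i = M i j) \<and>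
     (\<forall>v. 0 \<le> (\<Sum>i\<in>A. \<Sum>j\<in>A. v i * M i j * v j))"

text \<open>For a Hermitian matrix the quadratic form is real, so only its real part is constrained.\<close>

definition psd_complex :: "'i set \<Rightarrow> ('i \<Rightarrow> 'i \<Rightarrow> complex) \<Rightarrow> bool" where
  "psd_complex A M \<longleftrightarrow>
     (\<forall>i\<in>A. \<forall>j\<in>A. M j i = cnj (M i j)) \<and>
     (\<forall>v. 0 \<le> Re (\<Sum>i\<in>A. \<Sum>j\<in>A. cnj (v i) * M i j * v j))"

definition in_kernel :: "nat \<Rightarrow> ('n::finite expo \<Rightarrow> 'n expo \<Rightarrow> 'k::field) \<Rightarrow> ('n, 'k) mpoly \<Rightarrow> bool" where
  "in_kernel s M f \<longleftrightarrow>
     mdegree f \<le> s \<and> (\<forall>\<alpha>\<in>expos s. (\<Sum>\<beta>\<in>expos s. M \<alpha> \<beta> * Poly_Mapping.lookup f \<beta>) = 0)"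

definition moment_real :: "('n expo \<Rightarrow> real) \<Rightarrow> 'n expo \<Rightarrow> 'n expo \<Rightarrow> real" where
  "moment_real y = (\<lambda>\<alpha> \<beta>. y (\<alpha> + \<beta>))"

definition shift_real :: "('n, real) mpoly \<Rightarrow> ('n expo \<Rightarrow> real) \<Rightarrow> 'n expo \<Rightarrow> real" where
  "shift_real h y = (\<lambda>\<alpha>. \<Sum>\<beta>\<in>Poly_Mapping.keys h. Poly_Mapping.lookup h \<beta> * y (\<alpha> + \<beta>))"

text \<open>
  Membership in \<open>extensional D\<close> makes \<open>y\<close> an element of \<open>K^D\<close>: its values outside \<open>D\<close> are fixed.
\<close>

definition K_real :: "(nat \<Rightarrow> ('n::finite, real) mpoly) \<Rightarrow> nat \<Rightarrow> nat \<Rightarrow> ('n expo \<Rightarrow> real) set" where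
  "K_real h m t =
     {y \<in> extensional (expos (2 * t)).
        y 0 = 1 \<and>
        psd_real (expos t) (moment_real y) \<and>
        (\<forall>j\<in>{1..m}. mat_eq (expos (t - half_deg (h j)))
                        (moment_real (shift_real (h j) y)) (\<lambda>_ _. 0))}"

definition expo_pairs :: "nat \<Rightarrow> ('n::finite expo \<times> 'n expo) set" where
  "expo_pairs t = {(\<alpha>, \<alpha>'). expo_deg \<alpha> + expo_deg \<alpha>' \<le> t}"

definition moment_complex :: "('n expo \<times> 'n expo \<Rightarrow> complex) \<Rightarrow> 'n expo \<Rightarrow> 'n expo \<Rightarrow> complex" where
  "moment_complex y = (\<lambda>\<alpha> \<beta>. y (\<alpha>, \<beta>))"

definition shift_complex ::
  "('n, complex) mpoly \<Rightarrow> ('n expo \<times> 'n expo \<Rightarrow> complex) \<Rightarrow> 'n expo \<times> 'n expo \<Rightarrow> complex" where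
  "shift_complex h y =
     (\<lambda>(\<alpha>, \<alpha>'). \<Sum>\<beta>\<in>Poly_Mapping.keys h. Poly_Mapping.lookup h \<beta> * y (\<alpha>', \<alpha> + \<beta>))"

definition K_complex ::
  "(nat \<Rightarrow> ('n::finite, complex) mpoly) \<Rightarrow> nat \<Rightarrow> nat \<Rightarrow> ('n expo \<times> 'n expo \<Rightarrow> complex) set" where
  "K_complex h m t =
     {y \<in> extensional (expo_pairs (2 * t)).
        y (0, 0) = 1 \<and>
        (\<forall>(\<alpha>, \<alpha>')\<in>expo_pairs (2 * t). y (\<alpha>', \<alpha>) = cnj (y (\<alpha>, \<alpha>'))) \<and>
        psd_complex (expos t) (moment_complex y) \<and>
        (\<forall>j\<in>{1..m}. mat_eq (expos (t - half_deg (h j)))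
                        (moment_complex (shift_complex (h j) y)) (\<lambda>_ _. 0))}"

text \<open>\<open>x^\<alpha>\<close> divides \<open>x^\<beta>\<close> iff \<open>\<beta> = \<alpha> + \<gamma>\<close> for some exponent \<open>\<gamma>\<close>.\<close>

definition order_ideal :: "'n expo set \<Rightarrow> bool" where
  "order_ideal B \<longleftrightarrow> (\<forall>\<alpha> \<gamma>. \<alpha> + \<gamma> \<in> B \<longrightarrow> \<alpha> \<in> B)"

definition var_times :: "'n \<Rightarrow> 'n expo \<Rightarrow> 'n expo" where
  "var_times k b = Poly_Mapping.single k 1 + b"

definition border :: "'n expo set \<Rightarrow> 'n expo set" where
  "border B = {var_times k b | k b. b \<in> B} - B"

text \<open>
  The monomials of \<open>B\<close> and of its border serve as their own indices: \<open>a b c\<close> is the coefficient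
  \<open>a\<^sub>i\<^sub>j\<close> for \<open>b = b\<^sub>i\<close> and \<open>c = c\<^sub>j\<close>.
\<close>

definition comb :: "'n expo set \<Rightarrow> ('n expo \<Rightarrow> 'k::comm_ring_1) \<Rightarrow> ('n, 'k) mpoly" where
  "comb B u = (\<Sum>b\<in>B. Poly_Mapping.single b (u b))"

definition border_poly ::
  "'n expo set \<Rightarrow> ('n expo \<Rightarrow> 'n expo \<Rightarrow> 'k::comm_ring_1) \<Rightarrow> 'n expo \<Rightarrow> ('n, 'k) mpoly" where
  "border_poly B a c = Poly_Mapping.single c 1 - comb B (\<lambda>b. a b c)"

definition border_prebasis :: "'n expo set \<Rightarrow> ('n, 'k::comm_ring_1) mpoly set \<Rightarrow> bool" where
  "border_prebasis B G \<longleftrightarrow> order_ideal B \<and> (\<exists>a. G = border_poly B a ` border B)"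

definition quotient_independent :: "('n, 'k::comm_ring_1) mpoly set \<Rightarrow> 'n expo set \<Rightarrow> bool" where
  "quotient_independent J B \<longleftrightarrow> (\<forall>u. comb B u \<in> J \<longrightarrow> (\<forall>b\<in>B. u b = 0))"

definition quotient_basis :: "('n, 'k::comm_ring_1) mpoly set \<Rightarrow> 'n expo set \<Rightarrow> bool" where
  "quotient_basis J B \<longleftrightarrow> quotient_independent J B \<and> (\<forall>f. \<exists>u. f - comb B u \<in> J)"

definition border_basis ::
  "'n expo set \<Rightarrow> ('n, 'k::comm_ring_1) mpoly set \<Rightarrow> ('n, 'k) mpoly set \<Rightarrow> bool" where
  "border_basis B G J \<longleftrightarrow>
     border_prebasis B G \<and> is_ideal J \<and> G \<subseteq> J \<and> quotient_independent J B"

text \<open>Row index \<open>r\<close>, column index \<open>b\<close>, both ranging over \<open>B\<close>.\<close>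

definition formal_mult ::
  "'n expo set \<Rightarrow> ('n expo \<Rightarrow> 'n expo \<Rightarrow> 'k::comm_ring_1) \<Rightarrow> 'n \<Rightarrow> 'n expo \<Rightarrow> 'n expo \<Rightarrow> 'k" where
  "formal_mult B a k =
     (\<lambda>r b. if var_times k b \<in> B then (if r = var_times k b then 1 else 0) else a r (var_times k b))"

end

theory Submission
  imports Defs
begin

text \<open>
  Four independent ideas carry the proof.

  Positive semidefiniteness. If the quadratic form of a positive semidefinite matrix \<open>M\<close> vanishes at
  \<open>v\<close>, then \<open>M v = 0\<close> (\<open>psd_isotropic_in_kernel\<close>). Hence kernel vectors of principal submatrices,
  padded with zeros, are kernel vectors of \<open>M\<close>, a maximum nonsingular principal submatrix has the
  size of the rank (\<open>card_max_nonsingular_principal\<close>), and the rank condition on \<open>B \<union> \<partial>B\<close> is equivalent to the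
  existence of kernel polynomials in border form (\<open>flat_iff_border_kernel\<close>).

  Maximal rank. The feasible set is convex and contains the evaluations at the points of \<open>V\<close>. The
  kernel at the midpoint of \<open>y\<close> and an evaluation is the intersection of both kernels, and by
  maximality of the rank it is no smaller than the kernel at \<open>y\<close> (\<open>max_rank_kernel_minimal\<close>). So every
  kernel polynomial vanishes on \<open>V\<close>, which gives \<open>J \<subseteq> I(V)\<close> and \<open>V \<subseteq> W\<close>.

  Commutation. Commuting formal multiplication matrices make \<open>K^B\<close> a module over the polynomial
  ring in which \<open>b \<in> B\<close> takes the unit vector of \<open>1\<close> to the unit vector of \<open>b\<close>, while the border
  polynomials act on it as zero; so \<open>B\<close> is independent modulo \<open>J\<close>
  (\<open>commuting_imp_quotient_independent\<close>). It spans the quotient by rewriting with the border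
  polynomials (\<open>border_quotient_spanning\<close>).

  Counting zeros. Evaluations at distinct points are linearly independent, and at the zeros of \<open>J\<close>
  they are determined by their values on \<open>B\<close>. So there are at most \<open>\<bar>B\<bar>\<close> zeros; if there are \<open>\<bar>B\<bar>\<close>,
  the matrix of the values of \<open>B\<close> is invertible and only elements of \<open>J\<close> vanish at all of them
  (\<open>card_zeros_le\<close>, \<open>vanishing_ideal_of_zeros\<close>).
\<close>

section \<open>Independent families and the rank of a matrix\<close>

text \<open>
  The columns of a matrix form a family rather than a set, because two of them may coincide.
\<close>

lemma (in vector_space) independent_family:
  assumes fin: "finite S"
    and indep: "\<And>u. (\<Sum>j\<in>S. scale (u j) (c j)) = 0 \<Longrightarrow> \<forall>j\<in>S. u j = 0"
  shows "inj_on c S" "independent (c ` S)"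
proof -
  show inj: "inj_on c S"
  proof (rule inj_onI, rule ccontr)
    fix i j assume ij: "i \<in> S" "j \<in> S" "c i = c j" "i \<noteq> j"
    define u where "u k = (if k = i then 1 else 0) - (if k = j then 1 else (0::'a))" for k
    have "(\<Sum>k\<in>S. scale (u k) (c k)) =
        (\<Sum>k\<in>S. if k = i then c k else 0) - (\<Sum>k\<in>S. if k = j then c k else 0)"
      unfolding sum_subtractf[symmetric]
      by (rule sum.cong) (auto simp: u_def scale_left_diff_distrib)
    also have "\<dots> = 0"
      using ij fin by simp
    finally have "u i = 0"
      using indep ij by blast
    then show False
      using ij by (simp add: u_def)
  qed
  show "independent (c ` S)"
  proof
    assume "dependent (c ` S)"
    then obtain u where u: "\<exists>v\<in>c ` S. u v \<noteq> 0" "(\<Sum>v\<in>c ` S. scale (u v) v) = 0"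
      using fin dependent_finite[of "c ` S"] by auto
    have "(\<Sum>j\<in>S. scale (u (c j)) (c j)) = 0"
      using u(2) by (simp add: sum.reindex[OF inj])
    from indep[OF this] u(1) show False by auto
  qed
qed

lemma (in vector_space) span_family:
  assumes "finite S" "inj_on c S" "x \<in> span (c ` S)"
  shows "\<exists>u. x = (\<Sum>j\<in>S. scale (u j) (c j))"
proof -
  obtain u where "x = (\<Sum>v\<in>c ` S. scale (u v) v)"
    using assms(1,3) span_finite[of "c ` S"] by auto
  then have "x = (\<Sum>j\<in>S. scale (u (c j)) (c j))"
    by (simp add: sum.reindex[OF assms(2)])
  then show ?thesis by (rule exI[of _ "\<lambda>j. u (c j)"])
qed

lemma (in vector_space) independent_spans_if_large:
  assumes "finite T" "independent S" "S \<subseteq> span T" "card T \<le> card S"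
  shows "T \<subseteq> span S"
proof (rule ccontr)
  assume "\<not> T \<subseteq> span S"
  then obtain x where x: "x \<in> T" "x \<notin> span S" by blast
  have fin: "finite S"
    using independent_span_bound[OF assms(1-3)] by simp
  have "independent (insert x S)" "x \<notin> S"
    using x assms(2) independent_insertI span_base by auto
  moreover have "insert x S \<subseteq> span T"
    using assms(3) x span_base by auto
  ultimately show False
    using independent_span_bound[OF assms(1), of "insert x S"] assms(4) fin by auto
qed

interpretation fun_space: vector_space "\<lambda>(c::'k::field) (v::'i \<Rightarrow> 'k) i. c * v i"
  by unfold_locales (auto simp: fun_eq_iff algebra_simps)

lemma sum_fun_apply: "(\<Sum>j\<in>S. f j) i = (\<Sum>j\<in>S. f j i)" for f :: "'j \<Rightarrow> 'i \<Rightarrow> 'k::comm_monoid_add"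
  by (induction S rule: infinite_finite_induct) auto

definition restricted_col :: "'i set \<Rightarrow> ('i \<Rightarrow> 'j \<Rightarrow> 'k::zero) \<Rightarrow> 'j \<Rightarrow> 'i \<Rightarrow> 'k" where
  "restricted_col A M j = (\<lambda>i. if i \<in> A then M i j else 0)"

definition cols_independent :: "'i set \<Rightarrow> 'j set \<Rightarrow> ('i \<Rightarrow> 'j \<Rightarrow> 'k::field) \<Rightarrow> bool" where
  "cols_independent A S M \<longleftrightarrow> (\<forall>u. (\<forall>i\<in>A. (\<Sum>j\<in>S. M i j * u j) = 0) \<longrightarrow> (\<forall>j\<in>S. u j = 0))"

lemma cols_independentD:
  assumes "cols_independent A S M" "\<And>i. i \<in> A \<Longrightarrow> (\<Sum>j\<in>S. M i j * u j) = 0" "j \<in> S"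
  shows "u j = 0"
  using assms unfolding cols_independent_def by blast

lemma combination_of_restricted_cols:
  "(\<Sum>j\<in>S. (\<lambda>i. u j * restricted_col A M j i)) i = (if i \<in> A then \<Sum>j\<in>S. M i j * u j else 0)"
  for M :: "'i \<Rightarrow> 'j \<Rightarrow> 'k::field"
  by (auto simp: sum_fun_apply restricted_col_def mult.commute)

lemma mat_rank_eq_dim: "mat_rank A M = fun_space.dim (restricted_col A M ` A)"
  unfolding mat_rank_def restricted_col_def[abs_def] ..

lemma cols_independent_family:
  assumes "finite S" "cols_independent A S M"
  shows "inj_on (restricted_col A M) S" "fun_space.independent (restricted_col A M ` S)"
proof -
  have *: "\<forall>j\<in>S. u j = 0" if "(\<Sum>j\<in>S. (\<lambda>i. u j * restricted_col A M j i)) = 0" for u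
  proof -
    have "(\<Sum>j\<in>S. M i j * u j) = 0" if "i \<in> A" for i
      using combination_of_restricted_cols[of u A M S i] \<open>_ = 0\<close> that by simp
    then show ?thesis
      using assms(2) unfolding cols_independent_def by blast
  qed
  show "inj_on (restricted_col A M) S"
    by (rule fun_space.independent_family(1)[OF assms(1) *])
  show "fun_space.independent (restricted_col A M ` S)"
    by (rule fun_space.independent_family(2)[OF assms(1) *])
qed

lemma mat_rank_obtain_cols:
  assumes "finite A"
  obtains S where "S \<subseteq> A" "cols_independent A S M" "card S = mat_rank A M"
proof -
  obtain T where T: "T \<subseteq> restricted_col A M ` A" "fun_space.independent T"
      "card T = mat_rank A M"
    using fun_space.basis_exists[of "restricted_col A M ` A"] unfolding mat_rank_eq_dim by metis
  then obtain S where S: "S \<subseteq> A" "inj_on (restricted_col A M) S" "T = restricted_col A M ` S"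
    by (meson subset_image_inj)
  have finS: "finite S"
    using S(1) assms finite_subset by blast
  have "cols_independent A S M"
    unfolding cols_independent_def
  proof (intro allI impI ballI)
    fix u j assume u: "\<forall>i\<in>A. (\<Sum>j\<in>S. M i j * u j) = 0" and j: "j \<in> S"
    define w where "w v = u (the_inv_into S (restricted_col A M) v)" for v
    have w: "w (restricted_col A M k) = u k" if "k \<in> S" for k
      using the_inv_into_f_f[OF S(2) that] by (simp add: w_def)
    have "(\<Sum>v\<in>T. (\<lambda>i. w v * v i)) = (\<Sum>k\<in>S. (\<lambda>i. u k * restricted_col A M k i))"
      unfolding S(3) sum.reindex[OF S(2)] by (rule sum.cong) (auto simp: w)
    also have "\<dots> = 0"
      by (rule ext) (use u in \<open>simp add: combination_of_restricted_cols\<close>)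
    finally have "\<forall>v\<in>T. w v = 0"
      using T(2) fun_space.dependent_finite[of T] finS S(3) by auto
    then show "u j = 0"
      using w[OF j] S(3) j by auto
  qed
  with S T show thesis
    by (intro that[of S]) (auto simp: card_image)
qed

lemma card_le_mat_rank:
  assumes "finite A" "S \<subseteq> A" "cols_independent A S M"
  shows "card S \<le> mat_rank A M"
proof -
  have S: "finite S" using assms finite_subset by blast
  note ind = cols_independent_family[OF S assms(3)]
  obtain T where T: "T \<subseteq> restricted_col A M ` A" "restricted_col A M ` A \<subseteq> fun_space.span T"
      "card T = mat_rank A M"
    using fun_space.basis_exists[of "restricted_col A M ` A"] unfolding mat_rank_eq_dim by metis
  have "restricted_col A M ` S \<subseteq> fun_space.span T"
    using T(2) assms(2) by blast
  moreover have "finite T"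
    using T(1) assms(1) finite_surj by blast
  ultimately have "card (restricted_col A M ` S) \<le> card T"
    using fun_space.independent_span_bound[of T] ind(2) by blast
  then show ?thesis
    by (simp add: card_image[OF ind(1)] T(3))
qed

lemma col_in_span_of_independent_cols:
  assumes "finite A" "S \<subseteq> A" "cols_independent A S M" "mat_rank A M \<le> card S" "j \<in> A"
  shows "\<exists>u. \<forall>i\<in>A. M i j = (\<Sum>k\<in>S. M i k * u k)"
proof -
  have S: "finite S" using assms finite_subset by blast
  note ind = cols_independent_family[OF S assms(3)]
  obtain T where T: "T \<subseteq> restricted_col A M ` A" "restricted_col A M ` A \<subseteq> fun_space.span T"
      "card T = mat_rank A M"
    using fun_space.basis_exists[of "restricted_col A M ` A"] unfolding mat_rank_eq_dim by metis
  have "T \<subseteq> fun_space.span (restricted_col A M ` S)"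
  proof (rule fun_space.independent_spans_if_large)
    show "finite T" using T(1) assms(1) finite_surj by blast
    show "restricted_col A M ` S \<subseteq> fun_space.span T" using T(2) assms(2) by blast
    show "card T \<le> card (restricted_col A M ` S)"
      using T(3) assms(4) by (simp add: card_image[OF ind(1)])
  qed (rule ind(2))
  then have "restricted_col A M j \<in> fun_space.span (restricted_col A M ` S)"
    using T(2) assms(5) fun_space.span_minimal[OF _ fun_space.subspace_span] by blast
  from fun_space.span_family[OF S ind(1) this] obtain u where
    u: "restricted_col A M j = (\<Sum>k\<in>S. (\<lambda>i. u k * restricted_col A M k i))" by blast
  have "M i j = (\<Sum>k\<in>S. M i k * u k)" if "i \<in> A" for i
    using fun_cong[OF u, of i] that
    unfolding combination_of_restricted_cols by (simp add: restricted_col_def)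
  then show ?thesis by blast
qed

lemma mat_rank_le_card:
  assumes "finite A" "S \<subseteq> A" "\<And>j. j \<in> A \<Longrightarrow> \<exists>u. \<forall>i\<in>A. M i j = (\<Sum>k\<in>S. M i k * u k)"
  shows "mat_rank A M \<le> card S"
proof -
  have S: "finite S" using assms finite_subset by blast
  have "restricted_col A M j \<in> fun_space.span (restricted_col A M ` S)" if j: "j \<in> A" for j
  proof -
    obtain u where u: "\<forall>i\<in>A. M i j = (\<Sum>k\<in>S. M i k * u k)" using assms(3)[OF j] by blast
    have "restricted_col A M j = (\<Sum>k\<in>S. (\<lambda>i. u k * restricted_col A M k i))"
      by (rule ext) (use u in \<open>simp add: combination_of_restricted_cols\<close>,
          simp add: restricted_col_def)
    then show ?thesis
      by (simp only:) (intro fun_space.span_sum fun_space.span_scale fun_space.span_base imageI)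
  qed
  then have "mat_rank A M \<le> card (restricted_col A M ` S)"
    unfolding mat_rank_eq_dim by (intro fun_space.dim_le_card) (use S in auto)
  also have "\<dots> \<le> card S" by (rule card_image_le[OF S])
  finally show ?thesis .
qed

text \<open>
  Independent columns inside a space of dimension \<open>\<bar>B\<bar>\<close> number at most \<open>\<bar>B\<bar>\<close>. If there are exactly
  that many, they span the unit vectors, and the coefficients form a right inverse \<open>L\<close>.
\<close>

lemma cols_independent_card_le:
  assumes "finite B" "finite F" "cols_independent B F e"
  shows "card F \<le> card B"
    and "card F = card B \<Longrightarrow>
      \<exists>L. \<forall>b\<in>B. \<forall>b'\<in>B. (\<Sum>w\<in>F. e b w * L w b') = (if b = b' then 1 else 0)"
proof -
  note ind = cols_independent_family[OF assms(2,3)]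
  define unit where "unit b = (\<lambda>i. if i = b then (1::'c) else 0)" for b :: 'a
  have "restricted_col B e w \<in> fun_space.span (unit ` B)" for w
  proof -
    have "restricted_col B e w = (\<Sum>b\<in>B. (\<lambda>i. e b w * unit b i))"
      using assms(1) by (auto simp: fun_eq_iff sum_fun_apply unit_def restricted_col_def if_distrib
          cong: if_cong)
    then show ?thesis
      by (simp only:) (intro fun_space.span_sum fun_space.span_scale fun_space.span_base imageI)
  qed
  then have sub: "restricted_col B e ` F \<subseteq> fun_space.span (unit ` B)" by blast
  have cu: "card (unit ` B) = card B"
    by (rule card_image) (metis inj_onI unit_def zero_neq_one)
  show "card F \<le> card B"
    using fun_space.independent_span_bound[OF _ ind(2) sub] assms(1)
    by (simp add: card_image[OF ind(1)] cu)
  assume eq: "card F = card B"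
  have span: "unit ` B \<subseteq> fun_space.span (restricted_col B e ` F)"
    by (rule fun_space.independent_spans_if_large[OF _ ind(2) sub])
      (use assms(1) eq in \<open>auto simp: card_image[OF ind(1)] cu\<close>)
  have "\<exists>u. \<forall>b\<in>B. (\<Sum>w\<in>F. e b w * u w) = (if b = b' then 1 else 0)" if b': "b' \<in> B" for b'
  proof -
    obtain u where u: "unit b' = (\<Sum>w\<in>F. (\<lambda>i. u w * restricted_col B e w i))"
      using fun_space.span_family[OF assms(2) ind(1), of "unit b'"] span b' by blast
    have "(\<Sum>w\<in>F. e b w * u w) = (if b = b' then 1 else 0)" if "b \<in> B" for b
      using fun_cong[OF u, of b] that
      unfolding combination_of_restricted_cols by (simp add: unit_def)
    then show ?thesis by blast
  qed
  then obtain U where "\<forall>b'\<in>B. \<forall>b\<in>B. (\<Sum>w\<in>F. e b w * U b' w) = (if b = b' then 1 else 0)"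
    by metis
  then show "\<exists>L. \<forall>b\<in>B. \<forall>b'\<in>B. (\<Sum>w\<in>F. e b w * L w b') = (if b = b' then 1 else 0)"
    by (intro exI[of _ "\<lambda>w b'. U b' w"]) auto
qed

lemma sum_delta_mult:
  "finite A \<Longrightarrow> j \<in> A \<Longrightarrow> (\<Sum>k\<in>A. (if j = k then 1 else 0) * u k) = u j"
  for u :: "'i \<Rightarrow> 'k::comm_ring_1"
  using sum.delta[of A j u] by (auto simp: if_distrib[of "\<lambda>x. x * _"] cong: if_cong)

lemma mat_mult_vec_assoc:
  "(\<Sum>j\<in>B. mat_mult A M N i j * u j) = (\<Sum>k\<in>A. M i k * (\<Sum>j\<in>B. N k j * u j))"
  for M :: "'i \<Rightarrow> 'i \<Rightarrow> 'k::comm_ring_1"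
  unfolding mat_mult_def sum_distrib_left sum_distrib_right
  by (subst sum.swap) (simp add: mult.assoc)

lemma nonsingular_iff_cols_independent:
  assumes fin: "finite A"
  shows "nonsingular A M \<longleftrightarrow> cols_independent A A M"
proof
  assume "nonsingular A M"
  then obtain N where N: "mat_eq A (mat_mult A N M) (\<lambda>i j. if i = j then 1 else 0)"
    unfolding nonsingular_def by blast
  show "cols_independent A A M"
    unfolding cols_independent_def
  proof (intro allI impI ballI)
    fix u j assume u: "\<forall>i\<in>A. (\<Sum>j\<in>A. M i j * u j) = 0" and j: "j \<in> A"
    have "u j = (\<Sum>k\<in>A. (if j = k then 1 else 0) * u k)"
      using fin j by (simp add: sum_delta_mult)
    also have "\<dots> = (\<Sum>k\<in>A. mat_mult A N M j k * u k)"
      using N j by (intro sum.cong) (auto simp: mat_eq_def)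
    also have "\<dots> = 0"
      using u by (simp add: mat_mult_vec_assoc)
    finally show "u j = 0" .
  qed
next
  assume ind: "cols_independent A A M"
  obtain N where N: "\<forall>i\<in>A. \<forall>j\<in>A. (\<Sum>k\<in>A. M i k * N k j) = (if i = j then 1 else 0)"
    using cols_independent_card_le(2)[OF fin fin ind refl] by blast
  \<comment> \<open>The right inverse is a left inverse: \<open>M (N M - 1) = 0\<close>, and \<open>M\<close> has trivial kernel.\<close>
  have "(\<Sum>k\<in>A. N i k * M k j) = (if i = j then 1 else 0)" if ij: "i \<in> A" "j \<in> A" for i j
  proof -
    have "(\<Sum>k\<in>A. M l k * ((\<Sum>p\<in>A. N k p * M p j) - (if k = j then 1 else 0))) = 0"
      if l: "l \<in> A" for l
    proof -
      have "(\<Sum>k\<in>A. M l k * (\<Sum>p\<in>A. N k p * M p j)) = (\<Sum>p\<in>A. mat_mult A M N l p * M p j)"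
        by (simp add: mat_mult_vec_assoc)
      also have "\<dots> = (\<Sum>p\<in>A. (if l = p then 1 else 0) * M p j)"
        using N l by (intro sum.cong) (auto simp: mat_mult_def)
      also have "\<dots> = M l j"
        using fin l by (simp add: sum_delta_mult)
      finally have "(\<Sum>k\<in>A. M l k * (\<Sum>p\<in>A. N k p * M p j)) = M l j" .
      moreover have "(\<Sum>k\<in>A. M l k * (if k = j then 1 else 0)) = M l j"
        using fin ij by (simp add: if_distrib[of "\<lambda>x. _ * x"] cong: if_cong)
      ultimately show ?thesis
        by (simp only: right_diff_distrib sum_subtractf) simp
    qed
    from cols_independentD[OF ind this ij(1)] show ?thesis by simp
  qed
  with N show "nonsingular A M"
    unfolding nonsingular_def mat_eq_def mat_mult_def by blast
qed

section \<open>Kernels of positive semidefinite matrices\<close>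

definition sesqui :: "'i set \<Rightarrow> ('i \<Rightarrow> 'i \<Rightarrow> complex) \<Rightarrow> ('i \<Rightarrow> complex) \<Rightarrow> ('i \<Rightarrow> complex) \<Rightarrow> complex" where
  "sesqui A M u v = (\<Sum>i\<in>A. \<Sum>j\<in>A. cnj (u i) * M i j * v j)"

lemma sesqui_add_scaled:
  "sesqui A M (\<lambda>i. u i + of_real r * g i) (\<lambda>i. u i + of_real r * g i) =
    sesqui A M u u + of_real r * (sesqui A M u g + sesqui A M g u) + of_real r^2 * sesqui A M g g"
proof -
  have "cnj (u i + of_real r * g i) * M i j * (u j + of_real r * g j) =
      cnj (u i) * M i j * u j + of_real r * (cnj (u i) * M i j * g j + cnj (g i) * M i j * u j) +
      of_real r^2 * (cnj (g i) * M i j * g j)" for i j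
    by (simp add: power2_eq_square) (simp add: algebra_simps)
  then show ?thesis
    unfolding sesqui_def by (simp only: sum.distrib distrib_left sum_distrib_left)
qed

lemma sesqui_hermitian:
  assumes "psd_complex A M"
  shows "sesqui A M u g = cnj (sesqui A M g u)"
proof -
  have "cnj (sesqui A M g u) = (\<Sum>i\<in>A. \<Sum>j\<in>A. cnj (u j) * M j i * g i)"
    unfolding sesqui_def cnj_sum
  proof (intro sum.cong refl)
    fix i j assume "i \<in> A" "j \<in> A"
    then have "cnj (M i j) = M j i"
      using assms unfolding psd_complex_def by metis
    then show "cnj (cnj (g i) * M i j * u j) = cnj (u j) * M j i * g i"
      by simp
  qed
  also have "\<dots> = sesqui A M u g"
    unfolding sesqui_def by (rule sum.swap)
  finally show ?thesis by simp
qed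

lemma linear_term_zero_if_nonneg:
  fixes a b :: real
  assumes "0 \<le> a" "0 \<le> b" "\<And>r. 0 \<le> 2 * r * a + r^2 * b"
  shows "a = 0"
proof -
  \<comment> \<open>Any \<open>r\<close> slightly below \<open>0\<close> would do; this one also covers the case \<open>b = 0\<close>.\<close>
  have "0 \<le> 2 * (- (a / (b + 1))) * a + (- (a / (b + 1)))^2 * b" by (rule assms(3))
  also have "\<dots> = - (a^2 * (b + 2) / (b + 1)^2)"
  proof -
    define c where "c = b + 1"
    have c: "c > 0" "b = c - 1" using assms(2) by (auto simp: c_def)
    show ?thesis
      unfolding c(2) using c(1) by (simp add: field_simps power2_eq_square)
  qed
  finally have "a^2 * (b + 2) / (b + 1)^2 \<le> 0" by simp
  then have "a^2 * (b + 2) \<le> 0"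
    using assms(2) by (simp add: divide_le_0_iff)
  then show ?thesis
    using assms(2) by (simp add: mult_le_0_iff)
qed

text \<open>
  A zero of the nonnegative quadratic form is a minimum of it, so the derivative there in the
  direction of \<open>M v\<close>, which is \<open>2 \<bar>M v\<bar>\<^sup>2\<close>, vanishes.
\<close>

lemma psd_isotropic_in_kernel:
  assumes fin: "finite A" and psd: "psd_complex A M" and zero: "Re (sesqui A M v v) = 0" and "i \<in> A"
  shows "(\<Sum>j\<in>A. M i j * v j) = 0"
proof -
  define g where "g i = (\<Sum>j\<in>A. M i j * v j)" for i
  have nonneg: "0 \<le> Re (sesqui A M u u)" for u
    using psd unfolding psd_complex_def sesqui_def by blast
  have gv: "sesqui A M g v = of_real (\<Sum>i\<in>A. (cmod (g i))^2)"
    unfolding sesqui_def of_real_sum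
  proof (rule sum.cong[OF refl])
    fix i
    have "(\<Sum>j\<in>A. cnj (g i) * M i j * v j) = cnj (g i) * g i"
      unfolding g_def[of i] by (simp add: sum_distrib_left mult.assoc)
    then show "(\<Sum>j\<in>A. cnj (g i) * M i j * v j) = of_real ((cmod (g i))^2)"
      unfolding complex_norm_square by (simp only: mult.commute)
  qed
  have "(\<Sum>i\<in>A. (cmod (g i))^2) = 0"
  proof (rule linear_term_zero_if_nonneg[where b = "Re (sesqui A M g g)"])
    show "0 \<le> 2 * r * (\<Sum>i\<in>A. (cmod (g i))^2) + r^2 * Re (sesqui A M g g)" for r :: real
    proof -
      have "0 \<le> Re (sesqui A M (\<lambda>i. v i + of_real r * g i) (\<lambda>i. v i + of_real r * g i))"
        by (rule nonneg)
      also have "\<dots> = 2 * r * (\<Sum>i\<in>A. (cmod (g i))^2) + r^2 * Re (sesqui A M g g)"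
        unfolding sesqui_add_scaled sesqui_hermitian[OF psd, of v g] gv
        by (simp add: zero flip: of_real_power)
      finally show ?thesis .
    qed
  qed (auto intro: sum_nonneg nonneg)
  then have "cmod (g i) ^ 2 = 0"
    using fin \<open>i \<in> A\<close> by (subst (asm) sum_nonneg_eq_0_iff) auto
  then show ?thesis by (simp add: g_def)
qed

text \<open>
  On a complex vector the form of a real symmetric matrix is the sum of its values on the real and
  the imaginary part.
\<close>

lemma psd_complex_of_real:
  assumes "psd_real A M"
  shows "psd_complex A (\<lambda>i j. complex_of_real (M i j))"
  unfolding psd_complex_def
proof (intro conjI allI ballI)
  show "complex_of_real (M j i) = cnj (complex_of_real (M i j))" if "i \<in> A" "j \<in> A" for i j
    using assms that by (simp add: psd_real_def)
  fix v :: "'a \<Rightarrow> complex"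
  have "Re (\<Sum>i\<in>A. \<Sum>j\<in>A. cnj (v i) * complex_of_real (M i j) * v j) =
      (\<Sum>i\<in>A. \<Sum>j\<in>A. Re (v i) * M i j * Re (v j)) + (\<Sum>i\<in>A. \<Sum>j\<in>A. Im (v i) * M i j * Im (v j))"
    by (simp add: sum.distrib[symmetric] algebra_simps)
  also have "0 \<le> \<dots>"
    using assms[unfolded psd_real_def, THEN conjunct2, rule_format, of "\<lambda>i. Re (v i)"]
      assms[unfolded psd_real_def, THEN conjunct2, rule_format, of "\<lambda>i. Im (v i)"]
    by (rule add_nonneg_nonneg)
  finally show "0 \<le> Re (\<Sum>i\<in>A. \<Sum>j\<in>A. cnj (v i) * complex_of_real (M i j) * v j)" .
qed

lemma psd_complex_subset:
  assumes "psd_complex A M" "S \<subseteq> A" "finite A"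
  shows "psd_complex S M"
  unfolding psd_complex_def
proof (intro conjI allI ballI)
  show "M j i = cnj (M i j)" if "i \<in> S" "j \<in> S" for i j
    using assms that unfolding psd_complex_def by blast
  fix v :: "'a \<Rightarrow> complex"
  define u where "u j = (if j \<in> S then v j else 0)" for j
  have "0 \<le> Re (\<Sum>i\<in>A. \<Sum>j\<in>A. cnj (u i) * M i j * u j)"
    using assms(1) unfolding psd_complex_def by blast
  also have "(\<Sum>i\<in>A. \<Sum>j\<in>A. cnj (u i) * M i j * u j) = (\<Sum>i\<in>S. \<Sum>j\<in>A. cnj (u i) * M i j * u j)"
    by (rule sum.mono_neutral_right) (use assms in \<open>auto simp: u_def\<close>)
  also have "\<dots> = (\<Sum>i\<in>S. \<Sum>j\<in>S. cnj (u i) * M i j * u j)"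
    by (intro sum.cong[OF refl] sum.mono_neutral_right) (use assms in \<open>auto simp: u_def\<close>)
  also have "\<dots> = (\<Sum>i\<in>S. \<Sum>j\<in>S. cnj (v i) * M i j * v j)"
    by (simp add: u_def)
  finally show "0 \<le> Re (\<Sum>i\<in>S. \<Sum>j\<in>S. cnj (v i) * M i j * v j)" .
qed

text \<open>
  The real and the complex case are treated together by viewing the coefficient field inside the
  complex numbers: a real positive semidefinite matrix becomes a Hermitian one. The target of
  the embedding is first a general ring, since coefficients are also used without leaving the field.
\<close>

locale coeff_hom =
  fixes \<iota> :: "'k::field \<Rightarrow> 'r::comm_ring_1"
  assumes hom_one: "\<iota> 1 = 1"
    and hom_add: "\<iota> (a + b) = \<iota> a + \<iota> b"
    and hom_mult: "\<iota> (a * b) = \<iota> a * \<iota> b"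
begin

lemma hom_zero: "\<iota> 0 = 0"
  using hom_add[of 0 0] by simp

lemma hom_sum: "\<iota> (\<Sum>i\<in>A. f i) = (\<Sum>i\<in>A. \<iota> (f i))"
  by (induction A rule: infinite_finite_induct) (auto simp: hom_zero hom_add)

lemma hom_eq_0_iff: "\<iota> a = 0 \<longleftrightarrow> a = 0"
proof
  show "a = 0" if "\<iota> a = 0"
  proof (rule ccontr)
    assume "a \<noteq> 0"
    then have "1 = \<iota> a * \<iota> (inverse a)"
      by (simp add: hom_one flip: hom_mult)
    with that show False by simp
  qed
qed (simp add: hom_zero)

end

locale complex_coeff = coeff_hom \<iota> for \<iota> :: "'k::field \<Rightarrow> complex"
begin

abbreviation psd :: "'i set \<Rightarrow> ('i \<Rightarrow> 'i \<Rightarrow> 'k) \<Rightarrow> bool" where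
  "psd A M \<equiv> psd_complex A (\<lambda>i j. \<iota> (M i j))"

text \<open>
  The value of the form on a vector supported on \<open>S\<close> only involves the principal submatrix of \<open>S\<close>,
  so a kernel vector of the submatrix, padded with zeros, is isotropic for the whole matrix.
\<close>

lemma psd_kernel_extend:
  assumes "finite A" "psd A M" "S \<subseteq> A"
    and zero: "\<And>i. i \<in> S \<Longrightarrow> (\<Sum>j\<in>S. M i j * u j) = 0" and "i \<in> A"
  shows "(\<Sum>j\<in>S. M i j * u j) = 0"
proof -
  define v where "v j = (if j \<in> S then \<iota> (u j) else 0)" for j
  have v: "(\<Sum>j\<in>A. \<iota> (M i j) * v j) = \<iota> (\<Sum>j\<in>S. M i j * u j)" for i
    unfolding hom_sum hom_mult
    by (rule sum.mono_neutral_cong_right) (use assms in \<open>auto simp: v_def\<close>)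
  have "sesqui A (\<lambda>i j. \<iota> (M i j)) v v = (\<Sum>i\<in>A. cnj (v i) * (\<Sum>j\<in>A. \<iota> (M i j) * v j))"
    by (simp add: sesqui_def sum_distrib_left mult.assoc)
  also have "\<dots> = 0"
    unfolding v by (intro sum.neutral) (auto simp: v_def zero hom_zero)
  finally have "(\<Sum>j\<in>A. \<iota> (M i j) * v j) = 0"
    by (intro psd_isotropic_in_kernel[OF assms(1,2) _ \<open>i \<in> A\<close>]) simp
  then show ?thesis
    by (simp add: v hom_eq_0_iff)
qed

text \<open>
  Two nonnegative forms with sum zero at a vector are both zero there.
\<close>

lemma psd_kernel_sum:
  assumes "finite A" "psd A M" "psd A M'"
    and zero: "\<And>i. i \<in> A \<Longrightarrow> (\<Sum>j\<in>A. (M i j + M' i j) * u j) = 0" and "i \<in> A"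
  shows "(\<Sum>j\<in>A. M i j * u j) = 0"
proof -
  define v where "v j = \<iota> (u j)" for j
  have v: "(\<Sum>j\<in>A. \<iota> (M i j) * v j) = \<iota> (\<Sum>j\<in>A. M i j * u j)" for i
    by (simp add: v_def hom_sum hom_mult)
  have "sesqui A (\<lambda>i j. \<iota> (M i j)) v v + sesqui A (\<lambda>i j. \<iota> (M' i j)) v v =
      (\<Sum>i\<in>A. cnj (v i) * \<iota> (\<Sum>j\<in>A. (M i j + M' i j) * u j))"
    unfolding v_def hom_sum hom_mult hom_add sesqui_def
    by (simp only: sum_distrib_left distrib_left distrib_right sum.distrib mult.assoc)
  also have "\<dots> = 0"
    by (intro sum.neutral) (auto simp: zero hom_zero)
  finally have "Re (sesqui A (\<lambda>i j. \<iota> (M i j)) v v) + Re (sesqui A (\<lambda>i j. \<iota> (M' i j)) v v) = 0"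
    unfolding plus_complex.sel(1)[symmetric] by simp
  moreover have "0 \<le> Re (sesqui A (\<lambda>i j. \<iota> (M i j)) v v)" "0 \<le> Re (sesqui A (\<lambda>i j. \<iota> (M' i j)) v v)"
    using assms(2,3) unfolding psd_complex_def sesqui_def by blast+
  ultimately have "Re (sesqui A (\<lambda>i j. \<iota> (M i j)) v v) = 0" by linarith
  from psd_isotropic_in_kernel[OF assms(1,2) this \<open>i \<in> A\<close>] show ?thesis
    by (simp add: v hom_eq_0_iff)
qed

text \<open>
  The kernel of the midpoint \<open>N\<close> is contained in the kernels of both ends; if \<open>N\<close> does not have
  larger rank than \<open>M\<close>, its kernel is therefore that of \<open>M\<close>. A maximal independent set of columns
  of \<open>M\<close> replaces the count of dimensions.
\<close>

lemma max_rank_kernel_minimal: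
  assumes fin: "finite A" and psd: "psd A M" "psd A M'"
    and mid: "\<And>i j. i \<in> A \<Longrightarrow> j \<in> A \<Longrightarrow> 2 * N i j = M i j + M' i j"
    and rank: "mat_rank A N \<le> mat_rank A M"
    and ker: "\<And>i. i \<in> A \<Longrightarrow> (\<Sum>j\<in>A. M i j * u j) = 0" and i: "i \<in> A"
  shows "(\<Sum>j\<in>A. M' i j * u j) = 0"
proof -
  have sum: "(\<Sum>j\<in>A. (M i j + M' i j) * w j) = 0"
    if "\<And>i. i \<in> A \<Longrightarrow> (\<Sum>j\<in>A. N i j * w j) = 0" "i \<in> A" for w i
  proof -
    have "(\<Sum>j\<in>A. (M i j + M' i j) * w j) = 2 * (\<Sum>j\<in>A. N i j * w j)"
      unfolding sum_distrib_left by (rule sum.cong) (use that mid in \<open>auto simp: mult.assoc[symmetric]\<close>)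
    with that show ?thesis by simp
  qed
  have N_ker: "(\<Sum>j\<in>A. M i j * w j) = 0" "(\<Sum>j\<in>A. M' i j * w j) = 0"
    if "\<And>i. i \<in> A \<Longrightarrow> (\<Sum>j\<in>A. N i j * w j) = 0" "i \<in> A" for w i
    using psd_kernel_sum[OF fin psd, of w i] psd_kernel_sum[OF fin psd(2,1), of w i] sum[of w] that
    by (simp_all add: add.commute)
  obtain S where S: "S \<subseteq> A" "cols_independent A S M" "card S = mat_rank A M"
    using mat_rank_obtain_cols[OF fin] by metis
  define ext where "ext w j = (if j \<in> S then w j else 0)" for w :: "'a \<Rightarrow> 'k" and j
  have ext: "(\<Sum>j\<in>A. K i j * ext w j) = (\<Sum>j\<in>S. K i j * w j)" for K :: "'a \<Rightarrow> 'a \<Rightarrow> 'k" and i w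
    by (rule sum.mono_neutral_cong_right) (use fin S(1) in \<open>auto simp: ext_def\<close>)
  have N_ind: "cols_independent A S N"
    unfolding cols_independent_def
  proof (intro allI impI)
    fix w assume w: "\<forall>i\<in>A. (\<Sum>j\<in>S. N i j * w j) = 0"
    have "(\<Sum>j\<in>S. M i j * w j) = 0" if "i \<in> A" for i
      using N_ker(1)[of "ext w" i] w that unfolding ext by blast
    with S(2) show "\<forall>j\<in>S. w j = 0" unfolding cols_independent_def by blast
  qed
  have "\<exists>w. \<forall>i\<in>A. N i j = (\<Sum>k\<in>S. N i k * w k)" if "j \<in> A" for j
    using col_in_span_of_independent_cols[OF fin S(1) N_ind _ that] rank S(3) by simp
  then obtain W where W: "\<And>i j. i \<in> A \<Longrightarrow> j \<in> A \<Longrightarrow> N i j = (\<Sum>k\<in>S. N i k * W j k)" by metis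
  \<comment> \<open>Restricted to \<open>S\<close>, \<open>w\<close> satisfies \<open>N u = N w\<close>; then \<open>M w = M u = 0\<close>, so \<open>w\<close> vanishes on \<open>S\<close> and \<open>N u = 0\<close>.\<close>
  define w where "w k = (\<Sum>j\<in>A. W j k * u j)" for k
  have Nw: "(\<Sum>j\<in>A. N i j * u j) = (\<Sum>k\<in>S. N i k * w k)" if "i \<in> A" for i
  proof -
    have "(\<Sum>j\<in>A. N i j * u j) = (\<Sum>j\<in>A. (\<Sum>k\<in>S. N i k * W j k) * u j)"
      using W that by (intro sum.cong) auto
    also have "\<dots> = (\<Sum>k\<in>S. N i k * w k)"
      unfolding w_def sum_distrib_left sum_distrib_right
      by (subst sum.swap) (simp add: mult.assoc)
    finally show ?thesis .
  qed
  have "(\<Sum>j\<in>A. N i j * (u j - ext w j)) = 0" if "i \<in> A" for i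
    using Nw[OF that] by (simp add: right_diff_distrib sum_subtractf ext)
  from N_ker(1)[OF this] have "(\<Sum>j\<in>S. M i j * w j) = 0" if "i \<in> A" for i
    using ker[OF that] that by (simp add: right_diff_distrib sum_subtractf ext)
  then have "w k = 0" if "k \<in> S" for k
    using cols_independentD[OF S(2)] that by blast
  then have "(\<Sum>j\<in>A. N i j * u j) = 0" if "i \<in> A" for i
    using Nw[OF that] by simp
  from N_ker(2)[OF this i] show ?thesis .
qed

lemma psd_cols_independent_principal:
  assumes "finite A" "psd A M" "S \<subseteq> A" "S \<subseteq> C" "C \<subseteq> A"
  shows "cols_independent C S M \<longleftrightarrow> cols_independent S S M"
proof
  assume ind: "cols_independent C S M"
  show "cols_independent S S M"
    unfolding cols_independent_def
  proof (intro allI impI)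
    fix u assume "\<forall>i\<in>S. (\<Sum>j\<in>S. M i j * u j) = 0"
    then have "(\<Sum>j\<in>S. M i j * u j) = 0" if "i \<in> C" for i
      using psd_kernel_extend[OF assms(1-3), of u i] assms(5) that by blast
    with ind show "\<forall>j\<in>S. u j = 0" unfolding cols_independent_def by blast
  qed
next
  assume "cols_independent S S M"
  then show "cols_independent C S M"
    using assms(4) unfolding cols_independent_def by blast
qed

text \<open>
  For a positive semidefinite matrix the rank is attained by principal submatrices: the column of
  an index outside a maximum nonsingular principal submatrix depends on the columns inside, because
  the enlarged principal submatrix is singular and its kernel vectors lie in the whole kernel.
\<close>

lemma card_max_nonsingular_principal:
  assumes fin: "finite A" and psd: "psd A M" and max: "max_nonsingular_principal A M B"
  shows "card B = mat_rank A M"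
proof (rule antisym)
  have B: "B \<subseteq> A" "nonsingular B M" "\<And>B'. B' \<subseteq> A \<Longrightarrow> nonsingular B' M \<Longrightarrow> card B' \<le> card B"
    using max unfolding max_nonsingular_principal_def by blast+
  have finB: "finite B" using B(1) fin finite_subset by blast
  have ind: "cols_independent B B M"
    using B(2) nonsingular_iff_cols_independent[OF finB] by blast
  then have "cols_independent A B M"
    using psd_cols_independent_principal[OF fin psd B(1) B(1)] by blast
  then show "card B \<le> mat_rank A M"
    by (rule card_le_mat_rank[OF fin B(1)])
  show "mat_rank A M \<le> card B"
  proof (rule mat_rank_le_card[OF fin B(1)])
    fix c assume c: "c \<in> A"
    show "\<exists>u. \<forall>i\<in>A. M i c = (\<Sum>k\<in>B. M i k * u k)"
    proof (cases "c \<in> B")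
      case True
      then have "\<forall>i\<in>A. M i c = (\<Sum>k\<in>B. M i k * (if k = c then 1 else 0))"
        using finB by (simp add: if_distrib cong: if_cong)
      then show ?thesis by (intro exI[of _ "\<lambda>k. if k = c then 1 else 0"])
    next
      case False
      then have "\<not> nonsingular (insert c B) M"
        using B(3)[of "insert c B"] c B(1) finB by auto
      then obtain u where u: "\<And>i. i \<in> insert c B \<Longrightarrow> (\<Sum>j\<in>insert c B. M i j * u j) = 0"
          "\<exists>j\<in>insert c B. u j \<noteq> 0"
        using nonsingular_iff_cols_independent[of "insert c B" M] finB
        unfolding cols_independent_def by auto
      have split: "(\<Sum>j\<in>insert c B. M i j * u j) = M i c * u c + (\<Sum>j\<in>B. M i j * u j)" for i
        using False finB by simp
      have "u c \<noteq> 0"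
      proof
        assume "u c = 0"
        then have "(\<Sum>j\<in>B. M i j * u j) = 0" if "i \<in> B" for i
          using u(1)[of i] that split by simp
        with ind have "\<forall>j\<in>B. u j = 0" unfolding cols_independent_def by blast
        with u(2) \<open>u c = 0\<close> show False by blast
      qed
      have "(\<Sum>j\<in>insert c B. M i j * u j) = 0" if "i \<in> A" for i
        by (rule psd_kernel_extend[OF fin psd _ u(1) that]) (use c B(1) in auto)
      then have "M i c * u c = - (\<Sum>j\<in>B. M i j * u j)" if "i \<in> A" for i
        using that split[of i] by (simp add: eq_neg_iff_add_eq_0)
      then have "M i c = (\<Sum>j\<in>B. M i j * (- u j / u c))" if "i \<in> A" for i
        using that \<open>u c \<noteq> 0\<close>
        by (simp add: sum_negf field_simps flip: sum_divide_distrib)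
      then show ?thesis by (intro exI[of _ "\<lambda>j. - u j / u c"] ballI)
    qed
  qed
qed

end

section \<open>Exponents and linear extensions to polynomials\<close>

lemma expo_deg_zero [simp]: "expo_deg 0 = 0"
  by (simp add: expo_deg_def)

lemma expo_deg_add: "expo_deg (\<alpha> + \<beta>) = expo_deg \<alpha> + expo_deg \<beta>"
  by (simp add: expo_deg_def lookup_add sum.distrib)

lemma expo_deg_single [simp]: "expo_deg (Poly_Mapping.single k 1) = 1"
proof -
  have "expo_deg (Poly_Mapping.single k 1) = (\<Sum>i\<in>UNIV. if i = k then 1 else 0)"
    unfolding expo_deg_def by (rule sum.cong) (auto simp: lookup_single when_def)
  then show ?thesis by simp
qed

lemma finite_expos [simp]: "finite (expos t)"
proof (rule finite_imageD)
  have "Poly_Mapping.lookup \<alpha> i \<le> t" if "\<alpha> \<in> expos t" for \<alpha> :: "'a expo" and i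
  proof -
    have "Poly_Mapping.lookup \<alpha> i \<le> expo_deg \<alpha>"
      unfolding expo_deg_def by (rule member_le_sum) auto
    then show ?thesis using that by (simp add: expos_def)
  qed
  then have "Poly_Mapping.lookup ` expos t \<subseteq> (UNIV :: 'a set) \<rightarrow>\<^sub>E {..t}" by auto
  then show "finite (Poly_Mapping.lookup ` (expos t :: 'a expo set))"
    by (rule finite_subset) (simp add: finite_PiE)
  show "inj_on Poly_Mapping.lookup (expos t :: 'a expo set)"
    by (simp add: inj_on_def lookup_inject)
qed

lemma expos_mono: "s \<le> t \<Longrightarrow> expos s \<subseteq> expos t"
  by (auto simp: expos_def)

lemma zero_in_expos [simp]: "0 \<in> expos t"
  by (simp add: expos_def)

lemma expo_induct [case_names zero var]:
  fixes \<alpha> :: "'n::finite expo"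
  assumes "P 0" and step: "\<And>k \<alpha>. P \<alpha> \<Longrightarrow> P (Poly_Mapping.single k 1 + \<alpha>)"
  shows "P \<alpha>"
proof (induction "expo_deg \<alpha>" arbitrary: \<alpha> rule: less_induct)
  case less
  show ?case
  proof (cases "\<alpha> = 0")
    case False
    then obtain k where k: "Poly_Mapping.lookup \<alpha> k \<noteq> 0"
      by (metis poly_mapping_eqI lookup_zero)
    define \<beta> where "\<beta> = \<alpha> - Poly_Mapping.single k 1"
    have \<alpha>: "\<alpha> = Poly_Mapping.single k 1 + \<beta>"
      by (rule poly_mapping_eqI)
        (use k in \<open>auto simp: \<beta>_def lookup_add lookup_minus lookup_single when_def\<close>)
    then have "expo_deg \<beta> < expo_deg \<alpha>"
      by (simp add: expo_deg_add del: One_nat_def)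
    then have "P \<beta>" by (rule less)
    then show ?thesis unfolding \<alpha> by (rule step)
  qed (simp add: assms(1))
qed

lemma mpoly_induct [case_names zero monomial add]:
  fixes f :: "('n, 'k::comm_ring_1) mpoly"
  assumes "P 0" "\<And>\<alpha> c. P (Poly_Mapping.single \<alpha> c)" "\<And>f g. P f \<Longrightarrow> P g \<Longrightarrow> P (f + g)"
  shows "P f"
proof -
  have "f = (\<Sum>\<alpha>\<in>Poly_Mapping.keys f. Poly_Mapping.single \<alpha> (Poly_Mapping.lookup f \<alpha>))"
    by (rule poly_mapping_eqI)
      (auto simp: lookup_sum lookup_single when_def in_keys_iff)
  moreover have "P (\<Sum>\<alpha>\<in>A. Poly_Mapping.single \<alpha> (Poly_Mapping.lookup f \<alpha>))" for A
    by (induction A rule: infinite_finite_induct) (auto intro: assms)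
  ultimately show ?thesis by metis
qed

text \<open>
  The map on polynomials that is given by its values on monomials and is linear along the
  coefficient map \<open>\<iota>\<close>. Evaluation at a point has this form, and so has each coordinate of the action
  of a polynomial on a vector.
\<close>

definition lin_ext ::
  "('k::zero \<Rightarrow> 'r::comm_ring_1) \<Rightarrow> ('n expo \<Rightarrow> 'r) \<Rightarrow> ('n, 'k) mpoly \<Rightarrow> 'r" where
  "lin_ext \<iota> F f = (\<Sum>\<alpha>\<in>Poly_Mapping.keys f. \<iota> (Poly_Mapping.lookup f \<alpha>) * F \<alpha>)"

context coeff_hom
begin

lemma lin_ext_eq_sum:
  assumes "finite S" "Poly_Mapping.keys f \<subseteq> S"
  shows "lin_ext \<iota> F f = (\<Sum>\<alpha>\<in>S. \<iota> (Poly_Mapping.lookup f \<alpha>) * F \<alpha>)"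
  unfolding lin_ext_def
  by (rule sum.mono_neutral_left) (use assms in \<open>auto simp: in_keys_iff hom_zero\<close>)

lemma lin_ext_zero [simp]: "lin_ext \<iota> F 0 = 0"
  by (simp add: lin_ext_def)

lemma lin_ext_add: "lin_ext \<iota> F (f + g) = lin_ext \<iota> F f + lin_ext \<iota> F g"
proof -
  let ?S = "Poly_Mapping.keys f \<union> Poly_Mapping.keys g"
  have "Poly_Mapping.keys (f + g) \<subseteq> ?S" by (rule keys_add)
  then show ?thesis
    using lin_ext_eq_sum[of ?S "f + g" F] lin_ext_eq_sum[of ?S f F] lin_ext_eq_sum[of ?S g F]
    by (simp add: lookup_add hom_add algebra_simps sum.distrib)
qed

lemma lin_ext_diff: "lin_ext \<iota> F (f - g) = lin_ext \<iota> F f - lin_ext \<iota> F g"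
  using lin_ext_add[of F "f - g" g] by simp

lemma lin_ext_single [simp]: "lin_ext \<iota> F (Poly_Mapping.single \<alpha> c) = \<iota> c * F \<alpha>"
  using lin_ext_eq_sum[of "{\<alpha>}" "Poly_Mapping.single \<alpha> c" F] by simp

lemma lin_ext_comb: "lin_ext \<iota> F (comb B u) = (\<Sum>b\<in>B. \<iota> (u b) * F b)"
  unfolding comb_def
  by (induction B rule: infinite_finite_induct) (auto simp: lin_ext_add)

lemma lin_ext_single_mult:
  "lin_ext \<iota> F (Poly_Mapping.single \<alpha> c * f) = \<iota> c * lin_ext \<iota> (\<lambda>\<beta>. F (\<alpha> + \<beta>)) f"
  by (induction f rule: mpoly_induct)
    (auto simp: mult_single hom_mult lin_ext_add algebra_simps)

lemma lin_ext_cmult: "lin_ext \<iota> (\<lambda>\<alpha>. r * F \<alpha>) f = r * lin_ext \<iota> F f"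
  by (simp add: lin_ext_def sum_distrib_left mult_ac)

lemma lin_ext_sum_fun: "lin_ext \<iota> (\<lambda>\<alpha>. \<Sum>i\<in>A. F i \<alpha>) f = (\<Sum>i\<in>A. lin_ext \<iota> (F i) f)"
  unfolding lin_ext_def sum_distrib_left by (rule sum.swap)

end

definition expo_eval :: "complex ^ 'n::finite \<Rightarrow> 'n expo \<Rightarrow> complex" where
  "expo_eval v \<alpha> = (\<Prod>i\<in>UNIV. (v $ i) ^ Poly_Mapping.lookup \<alpha> i)"

lemma mpoly_eval_eq_lin_ext: "mpoly_eval \<iota> f v = lin_ext \<iota> (expo_eval v) f"
  unfolding mpoly_eval_def lin_ext_def expo_eval_def ..

lemma expo_eval_zero [simp]: "expo_eval v 0 = 1"
  by (simp add: expo_eval_def)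

lemma expo_eval_add: "expo_eval v (\<alpha> + \<beta>) = expo_eval v \<alpha> * expo_eval v \<beta>"
  by (simp add: expo_eval_def lookup_add power_add prod.distrib)

lemma expo_eval_single: "expo_eval v (Poly_Mapping.single k 1) = v $ k"
proof -
  have "expo_eval v (Poly_Mapping.single k 1) = (\<Prod>i\<in>UNIV. if i = k then v $ i else 1)"
    unfolding expo_eval_def by (rule prod.cong) (auto simp: lookup_single when_def)
  then show ?thesis by simp
qed

lemma (in complex_coeff) mpoly_eval_mult:
  "mpoly_eval \<iota> (f * g) v = mpoly_eval \<iota> f v * mpoly_eval \<iota> g v"
  unfolding mpoly_eval_eq_lin_ext
  by (induction f rule: mpoly_induct)
    (auto simp: lin_ext_single_mult expo_eval_add lin_ext_cmult lin_ext_add distrib_right)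

interpretation poly_module: module "(*) :: 'a::comm_ring_1 \<Rightarrow> 'a \<Rightarrow> 'a"
  by unfold_locales (auto simp: algebra_simps)

lemma ideal_gen_induct [consumes 1, case_names zero step]:
  assumes "f \<in> ideal_gen A" "P 0" "\<And>r g h. g \<in> A \<Longrightarrow> P h \<Longrightarrow> P (r * g + h)"
  shows "P f"
  using assms(1) unfolding ideal_gen_def
  by (rule poly_module.span_induct_alt) (use assms(2,3) in auto)

lemma ideal_gen_superset: "g \<in> A \<Longrightarrow> g \<in> ideal_gen A"
  unfolding ideal_gen_def by (rule poly_module.span_base)

lemma is_ideal_ideal_gen: "is_ideal (ideal_gen A)"
  unfolding ideal_gen_def is_ideal_def by (rule poly_module.subspace_span)

lemma ideal_gen_mult: "f \<in> ideal_gen A \<Longrightarrow> r * f \<in> ideal_gen A"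
  unfolding ideal_gen_def by (rule poly_module.span_scale)

lemma ideal_gen_add: "f \<in> ideal_gen A \<Longrightarrow> g \<in> ideal_gen A \<Longrightarrow> f + g \<in> ideal_gen A"
  unfolding ideal_gen_def by (rule poly_module.span_add)

lemma ideal_gen_zero: "0 \<in> ideal_gen A"
  unfolding ideal_gen_def by (rule poly_module.span_zero)

lemma (in complex_coeff) mpoly_eval_ideal_gen:
  assumes "f \<in> ideal_gen A" "\<And>g. g \<in> A \<Longrightarrow> mpoly_eval \<iota> g v = 0"
  shows "mpoly_eval \<iota> f v = 0"
  using assms(1)
proof (induction rule: ideal_gen_induct)
  case (step r g h)
  then show ?case
    using mpoly_eval_mult[of r g v] assms(2)[of g]
    by (simp add: mpoly_eval_eq_lin_ext lin_ext_add)
qed (simp add: mpoly_eval_eq_lin_ext)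

section \<open>Border bases from commuting formal multiplication matrices\<close>

text \<open>
  The operator of \<open>x^\<alpha>\<close> is the product of powers of the \<open>T k\<close> along a fixed enumeration of the
  variables; one more factor \<open>T k\<close> can be moved to its place because the operators commute.
\<close>

lemma monomial_operators_exist:
  fixes T :: "'n::finite \<Rightarrow> 'a \<Rightarrow> 'a"
  assumes comm: "\<And>k l. T k \<circ> T l = T l \<circ> T k"
  shows "\<exists>P. P 0 = id \<and> (\<forall>k \<alpha>. P (Poly_Mapping.single k 1 + \<alpha>) = T k \<circ> P (\<alpha> :: 'n expo))"
proof -
  define P where "P xs \<alpha> = foldr (\<lambda>k g. (T k ^^ Poly_Mapping.lookup \<alpha> k) \<circ> g) xs id"
    for xs :: "'n list" and \<alpha> :: "'n expo"
  have comm_pow: "(T l ^^ m) \<circ> T k = T k \<circ> (T l ^^ m)" for k l m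
  proof (induction m)
    case (Suc m)
    have "(T l ^^ Suc m) \<circ> T k = T l \<circ> ((T l ^^ m) \<circ> T k)" by (simp add: comp_assoc)
    also have "\<dots> = (T l \<circ> T k) \<circ> (T l ^^ m)" by (simp only: Suc comp_assoc)
    also have "\<dots> = T k \<circ> (T l ^^ Suc m)" by (simp only: comm[of l k] comp_assoc funpow.simps)
    finally show ?case .
  qed simp
  have step: "P xs (Poly_Mapping.single k 1 + \<alpha>) = (if k \<in> set xs then T k \<circ> P xs \<alpha> else P xs \<alpha>)"
    if "distinct xs" for xs k \<alpha>
    using that
  proof (induction xs)
    case Nil
    then show ?case by (simp add: P_def)
  next
    case (Cons l xs)
    have Pl: "P (l # xs) \<beta> = (T l ^^ Poly_Mapping.lookup \<beta> l) \<circ> P xs \<beta>" for \<beta>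
      by (simp add: P_def)
    show ?case
    proof (cases "k = l")
      case True
      with Cons show ?thesis
        unfolding Pl by (simp add: lookup_add comp_assoc)
    next
      case False
      with Cons show ?thesis
        unfolding Pl
        by (auto simp: lookup_add lookup_single when_def fun_eq_iff comm_pow[unfolded fun_eq_iff comp_def, rule_format])
    qed
  qed
  obtain xs :: "'n list" where xs: "set xs = UNIV" "distinct xs"
    using finite_distinct_list[of "UNIV :: 'n set"] by auto
  have "P xs 0 = id" by (induction xs) (auto simp: P_def)
  with step[OF xs(2)] xs(1) show ?thesis by (intro exI[of _ "P xs"]) auto
qed

text \<open>
  Commuting matrices turn \<open>K^B\<close> into a module over the polynomial ring; acting on the unit vector of
  the monomial \<open>1\<close> is a linear map from polynomials to \<open>K^B\<close>. By induction along the order ideal it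
  sends each \<open>b \<in> B\<close> to its unit vector, so it kills every border polynomial, and with it the ideal
  they generate. A combination of \<open>B\<close> in the ideal thus has zero coefficients.
\<close>

lemma commuting_imp_quotient_independent:
  fixes B :: "'n::finite expo set" and a :: "'n expo \<Rightarrow> 'n expo \<Rightarrow> 'k::field"
  assumes fin: "finite B" and order: "order_ideal B" and zero: "0 \<in> B"
    and comm: "\<forall>k l. mat_eq B (mat_mult B (formal_mult B a k) (formal_mult B a l))
                        (mat_mult B (formal_mult B a l) (formal_mult B a k))"
  shows "quotient_independent (ideal_gen (border_poly B a ` border B)) B"
proof -
  interpret coeff_hom "\<lambda>c::'k. c"
    by unfold_locales auto
  define T where "T k u r = (if r \<in> B then \<Sum>b\<in>B. formal_mult B a k r b * u b else 0)"
    for k and u :: "'n expo \<Rightarrow> 'k" and r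
  have TT: "T k (T l u) r = (if r \<in> B then
      \<Sum>b\<in>B. mat_mult B (formal_mult B a k) (formal_mult B a l) r b * u b else 0)" for k l u r
    unfolding mat_mult_vec_assoc by (auto simp: T_def)
  have "T k (T l u) r = T l (T k u) r" for k l u r
    unfolding TT using comm[rule_format, of k l] by (auto simp: mat_eq_def intro!: sum.cong)
  then have "T k \<circ> T l = T l \<circ> T k" for k l
    by (simp add: fun_eq_iff)
  from monomial_operators_exist[of T, OF this] obtain P where
    P: "P 0 = id" "\<And>k \<alpha>. P (Poly_Mapping.single k 1 + \<alpha>) = T k \<circ> P (\<alpha> :: 'n expo)" by blast
  define \<Phi> where "\<Phi> \<alpha> = P \<alpha> (\<lambda>r. if r = 0 then 1 else 0)" for \<alpha>
  have \<Phi>0: "\<Phi> 0 r = (if r = 0 then 1 else 0)" for r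
    by (simp add: \<Phi>_def P(1))
  have \<Phi>_var: "\<Phi> (Poly_Mapping.single k 1 + \<alpha>) r = (\<Sum>b\<in>B. formal_mult B a k r b * \<Phi> \<alpha> b)"
    if "r \<in> B" for k \<alpha> r
    using that by (simp only: \<Phi>_def P(2) comp_def T_def if_True)
  have \<Phi>_unit: "\<forall>r\<in>B. \<Phi> \<alpha> r = (if r = \<alpha> then 1 else 0)" if "\<alpha> \<in> B" for \<alpha>
    using that
  proof (induction \<alpha> rule: expo_induct)
    case zero
    then show ?case by (simp add: \<Phi>0)
  next
    case (var k \<alpha>)
    then have "\<alpha> \<in> B"
      using order unfolding order_ideal_def by (metis add.commute)
    with var have IH: "\<And>b. b \<in> B \<Longrightarrow> \<Phi> \<alpha> b = (if b = \<alpha> then 1 else 0)" by blast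
    have "\<Phi> (Poly_Mapping.single k 1 + \<alpha>) r = formal_mult B a k r \<alpha>" if "r \<in> B" for r
    proof -
      have "\<Phi> (Poly_Mapping.single k 1 + \<alpha>) r = (\<Sum>b\<in>B. if b = \<alpha> then formal_mult B a k r b else 0)"
        unfolding \<Phi>_var[OF that] by (rule sum.cong) (auto simp: IH)
      then show ?thesis using fin \<open>\<alpha> \<in> B\<close> by simp
    qed
    with var show ?case
      by (auto simp: formal_mult_def var_times_def)
  qed
  have \<Phi>_border: "\<Phi> c r = a r c" if c: "c \<in> border B" and r: "r \<in> B" for c r
  proof -
    obtain k \<alpha> where k: "c = var_times k \<alpha>" "\<alpha> \<in> B" "c \<notin> B"
      using c unfolding border_def by blast
    have "\<Phi> c r = (\<Sum>b\<in>B. formal_mult B a k r b * \<Phi> \<alpha> b)"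
      unfolding k(1) var_times_def using \<Phi>_var[OF r] .
    also have "\<dots> = (\<Sum>b\<in>B. if b = \<alpha> then formal_mult B a k r b else 0)"
      by (rule sum.cong) (use \<Phi>_unit[OF k(2)] in auto)
    also have "\<dots> = a r c"
      using fin k by (simp add: formal_mult_def)
    finally show ?thesis .
  qed
  have eval_comb: "lin_ext (\<lambda>c. c) (\<lambda>\<alpha>. \<Phi> \<alpha> r) (comb B u) = u r" if "r \<in> B" for u r
  proof -
    have "lin_ext (\<lambda>c. c) (\<lambda>\<alpha>. \<Phi> \<alpha> r) (comb B u) = (\<Sum>b\<in>B. if b = r then u b else 0)"
      unfolding lin_ext_comb by (rule sum.cong) (use \<Phi>_unit that in auto)
    then show ?thesis using fin that by simp
  qed
  define killed where "killed f \<longleftrightarrow> (\<forall>r\<in>B. lin_ext (\<lambda>c. c) (\<lambda>\<alpha>. \<Phi> \<alpha> r) f = 0)" for f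
  have killed_var: "killed (Poly_Mapping.single (Poly_Mapping.single k 1) 1 * f)" if "killed f" for k f
    unfolding killed_def
  proof
    fix r assume r: "r \<in> B"
    have "lin_ext (\<lambda>c. c) (\<lambda>\<alpha>. \<Phi> \<alpha> r) (Poly_Mapping.single (Poly_Mapping.single k 1) 1 * f)
        = (\<Sum>b\<in>B. formal_mult B a k r b * lin_ext (\<lambda>c. c) (\<lambda>\<alpha>. \<Phi> \<alpha> b) f)"
      unfolding lin_ext_single_mult \<Phi>_var[OF r] lin_ext_sum_fun lin_ext_cmult by simp
    also have "\<dots> = 0"
      using that by (simp add: killed_def)
    finally show "lin_ext (\<lambda>c. c) (\<lambda>\<alpha>. \<Phi> \<alpha> r) (Poly_Mapping.single (Poly_Mapping.single k 1) 1 * f) = 0" .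
  qed
  have killed_monomial: "killed (Poly_Mapping.single \<alpha> c * f)" if "killed f" for \<alpha> c f
  proof (induction \<alpha> rule: expo_induct)
    case zero
    have "killed (Poly_Mapping.single 0 c * f)"
      using that unfolding killed_def lin_ext_single_mult by simp
    then show ?case .
  next
    case (var k \<alpha>)
    from killed_var[OF this, of k] show ?case
      by (simp add: mult.assoc[symmetric] mult_single)
  qed
  have killed_mult: "killed (p * f)" if "killed f" for p f
    by (induction p rule: mpoly_induct)
      (use killed_monomial[OF that] in \<open>auto simp: killed_def distrib_right lin_ext_add\<close>)
  have killed_ideal: "killed f" if "f \<in> ideal_gen (border_poly B a ` border B)" for f
    using that
  proof (induction rule: ideal_gen_induct)
    case zero
    then show ?case by (simp add: killed_def)
  next
    case (step p g h)
    then obtain c where c: "c \<in> border B" "g = border_poly B a c" by blast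
    have "killed g"
      unfolding killed_def c(2) border_poly_def lin_ext_diff
      using \<Phi>_border[OF c(1)] eval_comb by simp
    from killed_mult[OF this, of p] step show ?case
      by (simp add: killed_def lin_ext_add)
  qed
  show ?thesis
    unfolding quotient_independent_def
    using killed_ideal eval_comb unfolding killed_def by metis
qed

lemma comb_add: "comb B u + comb B w = comb B (\<lambda>b. u b + w b)"
  unfolding comb_def by (simp add: single_add sum.distrib)

text \<open>
  By induction on the monomial: multiplying a combination of \<open>B\<close> by a variable gives terms in \<open>B\<close>,
  and terms in the border, which the border polynomials rewrite into combinations of \<open>B\<close>.
\<close>

lemma border_quotient_spanning:
  fixes B :: "'n::finite expo set" and a :: "'n expo \<Rightarrow> 'n expo \<Rightarrow> 'k::field"
  assumes fin: "finite B" and zero: "0 \<in> B"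
  shows "\<exists>u. f - comb B u \<in> ideal_gen (border_poly B a ` border B)"
proof -
  define J where "J = ideal_gen (border_poly B a ` border B)"
  define reducible where "reducible f \<longleftrightarrow> (\<exists>u. f - comb B u \<in> J)" for f
  have red_add: "reducible (f + g)" if fg: "reducible f" "reducible g" for f g
  proof -
    obtain u w where "f - comb B u \<in> J" "g - comb B w \<in> J"
      using fg unfolding reducible_def by blast
    then have "(f - comb B u) + (g - comb B w) \<in> J"
      unfolding J_def by (rule ideal_gen_add)
    also have "(f - comb B u) + (g - comb B w) = f + g - comb B (\<lambda>b. u b + w b)"
      unfolding comb_add[symmetric] by (simp add: algebra_simps)
    finally show ?thesis unfolding reducible_def by blast
  qed
  have red_J: "reducible f" if "f \<in> J" for f
    unfolding reducible_def
    by (rule exI[of _ "\<lambda>_. 0"]) (use that in \<open>simp add: comb_def\<close>)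
  have red_zero: "reducible 0"
    by (rule red_J) (simp add: J_def ideal_gen_zero)
  have red_comb: "reducible (comb B u)" for u
    unfolding reducible_def by (rule exI[of _ u]) (simp add: J_def ideal_gen_zero)
  have red_B: "reducible (Poly_Mapping.single b c)" if "b \<in> B" for b c
  proof -
    have "comb B (\<lambda>b'. if b' = b then c else 0)
        = (\<Sum>b'\<in>B. if b' = b then Poly_Mapping.single b' c else 0)"
      unfolding comb_def by (rule sum.cong) auto
    then have "comb B (\<lambda>b'. if b' = b then c else 0) = Poly_Mapping.single b c"
      using fin that by simp
    with red_comb show ?thesis by metis
  qed
  have red_border: "reducible (Poly_Mapping.single d c)" if d: "d \<in> border B" for d c
  proof -
    have "Poly_Mapping.single 0 c * border_poly B a d \<in> J"
      unfolding J_def by (intro ideal_gen_mult ideal_gen_superset imageI d)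
    moreover have "Poly_Mapping.single d c =
        Poly_Mapping.single 0 c * border_poly B a d + comb B (\<lambda>b. c * a b d)"
      unfolding border_poly_def right_diff_distrib comb_def sum_distrib_left
      by (simp add: mult_single)
    ultimately show ?thesis
      using red_add red_J red_comb by metis
  qed
  have red_sum: "reducible (\<Sum>i\<in>S. g i)" if "\<And>i. i \<in> S \<Longrightarrow> reducible (g i)" for S :: "'n expo set" and g
    using that
    by (induction S rule: infinite_finite_induct)
      (auto intro: red_add red_zero)
  have red_monomial: "reducible (Poly_Mapping.single \<alpha> c)" for \<alpha> c
  proof (induction \<alpha> arbitrary: c rule: expo_induct)
    case zero
    show ?case by (rule red_B[OF assms(2)])
  next
    case (var k \<alpha>)
    then obtain u where u: "Poly_Mapping.single \<alpha> c - comb B u \<in> J"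
      unfolding reducible_def by blast
    let ?x = "Poly_Mapping.single (Poly_Mapping.single k 1) (1::'k)"
    have "reducible (Poly_Mapping.single (Poly_Mapping.single k 1 + b) (u b))" if "b \<in> B" for b
    proof (cases "Poly_Mapping.single k 1 + b \<in> B")
      case False
      then have "Poly_Mapping.single k 1 + b \<in> border B"
        using that unfolding border_def var_times_def by blast
      then show ?thesis by (rule red_border)
    qed (rule red_B)
    then have "reducible (?x * comb B u)"
      unfolding comb_def sum_distrib_left by (intro red_sum) (simp add: mult_single)
    moreover have "reducible (?x * (Poly_Mapping.single \<alpha> c - comb B u))"
      using u unfolding J_def by (intro red_J[unfolded J_def] ideal_gen_mult)
    ultimately have "reducible (?x * (Poly_Mapping.single \<alpha> c - comb B u) + ?x * comb B u)"
      by (intro red_add)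
    then show ?case
      by (simp add: right_diff_distrib mult_single)
  qed
  have "reducible f"
    by (induction f rule: mpoly_induct) (auto intro: red_add red_monomial red_zero)
  then show ?thesis
    unfolding reducible_def J_def .
qed

section \<open>Counting the zeros of the border ideal\<close>

text \<open>
  Evaluations at distinct points are distinct characters of the monoid of exponents, so this is
  Dedekind's independence of characters: multiplying the relation by \<open>x\<^sub>k - v\<^sub>k\<close> removes the point \<open>v\<close>.
\<close>

lemma evaluations_independent:
  fixes F :: "(complex ^ 'n::finite) set"
  assumes "finite F" "\<And>\<alpha>. (\<Sum>w\<in>F. \<mu> w * expo_eval w \<alpha>) = 0" "w \<in> F"
  shows "\<mu> w = 0"
  using assms
proof (induction F arbitrary: \<mu> w rule: finite_induct)
  case (insert v F)
  have F0: "\<mu> w = 0" if w: "w \<in> F" for w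
  proof -
    have "w \<noteq> v" using w insert by blast
    then obtain k where k: "w $ k \<noteq> v $ k" by (auto simp: vec_eq_iff)
    have "(\<Sum>w\<in>F. (\<mu> w * (w $ k - v $ k)) * expo_eval w \<alpha>) = 0" for \<alpha>
    proof -
      have "(\<Sum>w\<in>F. (\<mu> w * (w $ k - v $ k)) * expo_eval w \<alpha>) =
          (\<Sum>w\<in>insert v F. (\<mu> w * (w $ k - v $ k)) * expo_eval w \<alpha>)"
        using insert by simp
      also have "\<dots> = (\<Sum>w\<in>insert v F. \<mu> w * expo_eval w (Poly_Mapping.single k 1 + \<alpha>)) -
          v $ k * (\<Sum>w\<in>insert v F. \<mu> w * expo_eval w \<alpha>)"
        unfolding sum_distrib_left sum_subtractf[symmetric]
        by (rule sum.cong[OF refl])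
          (simp only: expo_eval_add expo_eval_single left_diff_distrib right_diff_distrib mult_ac)
      also have "\<dots> = 0"
        using insert.prems(1)[of "Poly_Mapping.single k 1 + \<alpha>"] insert.prems(1)[of \<alpha>]
        by (simp only: mult_zero_right diff_zero)
      finally show ?thesis .
    qed
    from insert.IH[OF this w] k show ?thesis by simp
  qed
  have "(\<Sum>w\<in>insert v F. \<mu> w * expo_eval w 0) = 0" by (rule insert.prems(1))
  with insert.hyps F0 have "\<mu> v = 0" by simp
  with F0 insert.prems(2) show ?case by blast
qed simp

context complex_coeff
begin

text \<open>
  Every monomial is congruent modulo \<open>J\<close> to a combination of \<open>B\<close>, so a linear relation between the
  evaluations at zeros of \<open>J\<close> that holds on \<open>B\<close> holds on all monomials, hence is trivial.
\<close>

lemma zeros_cols_independent: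
  fixes B :: "'n::finite expo set"
  assumes span: "\<And>f. \<exists>u. f - comb B u \<in> J"
    and F: "finite F" "F \<subseteq> complex_variety \<iota> J"
  shows "cols_independent B F (\<lambda>b w. expo_eval w b)"
  unfolding cols_independent_def
proof (intro allI impI ballI)
  fix \<mu> w assume rel: "\<forall>b\<in>B. (\<Sum>w\<in>F. expo_eval w b * \<mu> w) = 0" and w: "w \<in> F"
  have "(\<Sum>w\<in>F. \<mu> w * expo_eval w \<alpha>) = 0" for \<alpha>
  proof -
    obtain u where u: "Poly_Mapping.single \<alpha> 1 - comb B u \<in> J" using span by blast
    have "expo_eval v \<alpha> = (\<Sum>b\<in>B. \<iota> (u b) * expo_eval v b)" if "v \<in> F" for v
    proof -
      have "mpoly_eval \<iota> (Poly_Mapping.single \<alpha> 1 - comb B u) v = 0"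
        using u F(2) that unfolding complex_variety_def by blast
      then show ?thesis
        by (simp add: mpoly_eval_eq_lin_ext lin_ext_diff lin_ext_comb hom_one)
    qed
    then have "(\<Sum>w\<in>F. \<mu> w * expo_eval w \<alpha>) = (\<Sum>w\<in>F. \<mu> w * (\<Sum>b\<in>B. \<iota> (u b) * expo_eval w b))"
      by (intro sum.cong) auto
    also have "\<dots> = (\<Sum>b\<in>B. \<iota> (u b) * (\<Sum>w\<in>F. expo_eval w b * \<mu> w))"
      unfolding sum_distrib_left by (subst sum.swap) (simp only: mult_ac)
    also have "\<dots> = 0" using rel by simp
    finally show ?thesis .
  qed
  then show "\<mu> w = 0" by (rule evaluations_independent[OF F(1) _ w])
qed

lemma card_zeros_le:
  fixes B :: "'n::finite expo set"
  assumes fin: "finite B" and span: "\<And>f. \<exists>u. f - comb B u \<in> J"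
  shows "finite (complex_variety \<iota> J) \<and> card (complex_variety \<iota> J) \<le> card B"
proof -
  have bound: "card F \<le> card B" if "finite F" "F \<subseteq> complex_variety \<iota> J" for F
    using cols_independent_card_le(1)[OF fin that(1) zeros_cols_independent[OF span that]] .
  have "finite (complex_variety \<iota> J)"
  proof (rule ccontr)
    assume "infinite (complex_variety \<iota> J)"
    from infinite_arbitrarily_large[OF this, of "Suc (card B)"] bound show False by fastforce
  qed
  with bound show ?thesis by blast
qed

text \<open>
  With \<open>\<bar>B\<bar>\<close> zeros the matrix of the values of \<open>B\<close> is invertible, so that a combination of \<open>B\<close> that
  vanishes at all zeros is zero: \<open>J\<close> is radical.
\<close>

lemma vanishing_ideal_of_zeros:
  fixes B :: "'n::finite expo set"
  assumes fin: "finite B" and span: "\<And>f. \<exists>u. f - comb B u \<in> J"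
    and card: "card (complex_variety \<iota> J) = card B"
  shows "vanishing_ideal \<iota> (complex_variety \<iota> J) = J"
proof
  let ?W = "complex_variety \<iota> J"
  show "J \<subseteq> vanishing_ideal \<iota> ?W"
    by (auto simp: vanishing_ideal_def complex_variety_def)
  show "vanishing_ideal \<iota> ?W \<subseteq> J"
  proof
    fix f assume f: "f \<in> vanishing_ideal \<iota> ?W"
    obtain u where u: "f - comb B u \<in> J" using span by blast
    have W: "finite ?W" using card_zeros_le[OF fin span] by blast
    have u_zero: "(\<Sum>b\<in>B. \<iota> (u b) * expo_eval v b) = 0" if v: "v \<in> ?W" for v
    proof -
      have "mpoly_eval \<iota> (f - comb B u) v = 0"
        using u v unfolding complex_variety_def by blast
      moreover have "mpoly_eval \<iota> f v = 0"
        using f v unfolding vanishing_ideal_def by blast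
      ultimately show ?thesis
        by (simp add: mpoly_eval_eq_lin_ext lin_ext_diff lin_ext_comb)
    qed
    obtain L where L: "\<forall>b\<in>B. \<forall>b'\<in>B. (\<Sum>w\<in>?W. expo_eval w b * L w b') = (if b = b' then 1 else 0)"
      using cols_independent_card_le(2)[OF fin W zeros_cols_independent[OF span W order_refl] card]
      by blast
    have "u c = 0" if c: "c \<in> B" for c
    proof -
      have "\<iota> (u c) = (\<Sum>b\<in>B. if b = c then \<iota> (u b) else 0)"
        using fin c by simp
      also have "\<dots> = (\<Sum>b\<in>B. \<iota> (u b) * (\<Sum>w\<in>?W. expo_eval w b * L w c))"
        using L c by (intro sum.cong) auto
      also have "\<dots> = (\<Sum>w\<in>?W. (\<Sum>b\<in>B. \<iota> (u b) * expo_eval w b) * L w c)"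
        unfolding sum_distrib_left sum_distrib_right by (subst sum.swap) (simp only: mult_ac)
      also have "\<dots> = 0"
        using u_zero by simp
      finally show ?thesis by (simp add: hom_eq_0_iff)
    qed
    then have "comb B u = 0" unfolding comb_def by simp
    with u show "f \<in> J" by simp
  qed
qed

end

section \<open>Border bases from the kernel of a moment matrix\<close>

lemma expo_deg_le_mdegree: "\<alpha> \<in> Poly_Mapping.keys f \<Longrightarrow> expo_deg \<alpha> \<le> mdegree f"
  unfolding mdegree_def by (rule Max_ge) auto

lemma mdegree_le_iff: "mdegree f \<le> s \<longleftrightarrow> Poly_Mapping.keys f \<subseteq> expos s"
  unfolding mdegree_def by (subst Max_le_iff) (auto simp: expos_def)

lemma border_subset_expos: "B \<subseteq> expos s \<Longrightarrow> border B \<subseteq> expos (Suc s)"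
  by (auto simp: border_def var_times_def expos_def expo_deg_add simp del: One_nat_def)

lemma lookup_border_poly:
  assumes "finite B"
  shows "Poly_Mapping.lookup (border_poly B a c) \<beta> =
    (if \<beta> = c then 1 else 0) - (if \<beta> \<in> B then a \<beta> c else 0)"
proof -
  have "Poly_Mapping.lookup (comb B (\<lambda>b. a b c)) \<beta> = (\<Sum>b\<in>B. if b = \<beta> then a b c else 0)"
    unfolding comb_def lookup_sum by (rule sum.cong) (auto simp: lookup_single when_def)
  then show ?thesis
    using assms by (simp add: border_poly_def lookup_minus lookup_single when_def)
qed

lemma mat_vec_border_poly:
  assumes "finite X" "B \<subseteq> X" "c \<in> X"
  shows "(\<Sum>\<beta>\<in>X. M \<beta> * Poly_Mapping.lookup (border_poly B a c) \<beta>) = M c - (\<Sum>b\<in>B. M b * a b c)"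
proof -
  have B: "finite B" using assms finite_subset by blast
  have "(\<Sum>\<beta>\<in>X. M \<beta> * Poly_Mapping.lookup (border_poly B a c) \<beta>) =
      (\<Sum>\<beta>\<in>X. if \<beta> = c then M \<beta> else 0) - (\<Sum>\<beta>\<in>X. if \<beta> \<in> B then M \<beta> * a \<beta> c else 0)"
    unfolding sum_subtractf[symmetric] lookup_border_poly[OF B]
    by (rule sum.cong) (auto simp: right_diff_distrib)
  also have "(\<Sum>\<beta>\<in>X. if \<beta> \<in> B then M \<beta> * a \<beta> c else 0) = (\<Sum>b\<in>B. M b * a b c)"
    using assms(1,2) by (simp add: sum.inter_restrict[symmetric] Int_absorb1)
  finally show ?thesis
    using assms(1,3) by simp
qed

lemma in_kernel_border_poly_iff:
  assumes "B \<subseteq> expos s" "c \<in> expos s"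
  shows "in_kernel s M (border_poly B a c) \<longleftrightarrow>
    (\<forall>\<alpha>\<in>expos s. M \<alpha> c = (\<Sum>b\<in>B. M \<alpha> b * a b c))"
proof -
  have "finite B" using assms(1) finite_expos finite_subset by blast
  then have "Poly_Mapping.keys (border_poly B a c) \<subseteq> insert c B"
    by (auto simp: in_keys_iff lookup_border_poly split: if_splits)
  then have "mdegree (border_poly B a c) \<le> s"
    using assms unfolding mdegree_le_iff by blast
  then show ?thesis
    unfolding in_kernel_def mat_vec_border_poly[OF finite_expos assms] by simp
qed

context complex_coeff
begin

lemma in_kernel_extend:
  assumes psd: "psd (expos t) M" and st: "s \<le> t" and ker: "in_kernel s M f"
  shows "in_kernel t M f"
proof -
  have f: "mdegree f \<le> s" "\<And>\<alpha>. \<alpha> \<in> expos s \<Longrightarrow> (\<Sum>\<beta>\<in>expos s. M \<alpha> \<beta> * Poly_Mapping.lookup f \<beta>) = 0"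
    using ker unfolding in_kernel_def by blast+
  have "(\<Sum>\<beta>\<in>expos t. M \<alpha> \<beta> * Poly_Mapping.lookup f \<beta>) = (\<Sum>\<beta>\<in>expos s. M \<alpha> \<beta> * Poly_Mapping.lookup f \<beta>)" for \<alpha>
    by (rule sum.mono_neutral_right)
      (use expos_mono[OF st] f(1) in \<open>auto simp: mdegree_le_iff in_keys_iff\<close>)
  then show ?thesis
    using psd_kernel_extend[OF finite_expos psd expos_mono[OF st] f(2)] f(1) st
    by (simp add: in_kernel_def)
qed

text \<open>
  A flat principal submatrix expresses the border columns by those of \<open>B\<close> on the rows of
  \<open>B \<union> \<partial>B\<close> only; positive semidefiniteness extends these relations to all rows of degree \<open>s\<close>.
\<close>

lemma flat_iff_border_kernel:
  fixes M :: "'n::finite expo \<Rightarrow> 'n expo \<Rightarrow> 'k"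
  assumes s: "1 \<le> s" and psd: "psd (expos s) M"
    and max: "max_nonsingular_principal (expos (s - 1)) M B"
  shows "mat_rank (B \<union> border B) M = mat_rank (expos (s - 1)) M \<longleftrightarrow>
    (\<exists>a. \<forall>c\<in>border B. in_kernel s M (border_poly B a c))"
proof -
  let ?C = "B \<union> border B"
  have Bs1: "B \<subseteq> expos (s - 1)" and nonsing: "nonsingular B M"
    using max unfolding max_nonsingular_principal_def by blast+
  have Bs: "B \<subseteq> expos s" using Bs1 expos_mono[of "s - 1" s] by auto
  have border: "border B \<subseteq> expos s" using border_subset_expos[OF Bs1] s by simp
  have fin: "finite ?C" "finite B"
    using Bs border finite_subset[OF _ finite_expos] by auto
  have "psd (expos (s - 1)) M"
    by (rule psd_complex_subset[OF psd expos_mono finite_expos]) simp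
  from card_max_nonsingular_principal[OF finite_expos this max]
  have rank: "mat_rank (expos (s - 1)) M = card B" by simp
  have psdC: "psd ?C M"
    by (rule psd_complex_subset[OF psd]) (use Bs border in auto)
  have ind: "cols_independent ?C B M"
    using nonsing nonsingular_iff_cols_independent[OF fin(2)]
      psd_cols_independent_principal[OF fin(1) psdC, of B ?C] by auto
  have "card B \<le> mat_rank ?C M"
    by (rule card_le_mat_rank[OF fin(1) _ ind]) simp
  then have flat_iff: "mat_rank ?C M = mat_rank (expos (s - 1)) M \<longleftrightarrow> mat_rank ?C M \<le> card B"
    unfolding rank by auto
  show ?thesis
    unfolding flat_iff
  proof
    assume le: "mat_rank ?C M \<le> card B"
    have "\<forall>c\<in>border B. \<exists>u. \<forall>i\<in>?C. M i c = (\<Sum>k\<in>B. M i k * u k)"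
      using col_in_span_of_independent_cols[OF fin(1) _ ind le] by blast
    from bchoice[OF this] obtain u where
      u: "\<And>c i. c \<in> border B \<Longrightarrow> i \<in> ?C \<Longrightarrow> M i c = (\<Sum>k\<in>B. M i k * u c k)"
      by blast
    define a where "a b c = u c b" for b c
    have "in_kernel s M (border_poly B a c)" if c: "c \<in> border B" for c
      unfolding in_kernel_border_poly_iff[OF Bs subsetD[OF border c]]
    proof
      fix i :: "'n expo" assume i: "i \<in> expos s"
      have split: "(\<Sum>j\<in>?C. M i j * Poly_Mapping.lookup (border_poly B a c) j) =
          M i c - (\<Sum>b\<in>B. M i b * a b c)" for i
        using mat_vec_border_poly[OF fin(1), of B c "M i" a] c by simp
      have "(\<Sum>j\<in>?C. M i j * Poly_Mapping.lookup (border_poly B a c) j) = 0"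
      proof (rule psd_kernel_extend[OF finite_expos psd _ _ i])
        show "(\<Sum>j\<in>?C. M i j * Poly_Mapping.lookup (border_poly B a c) j) = 0" if "i \<in> ?C" for i
          unfolding split a_def using u[OF c that] by simp
      qed (use Bs border in auto)
      then show "M i c = (\<Sum>b\<in>B. M i b * a b c)"
        unfolding split by simp
    qed
    then show "\<exists>a. \<forall>c\<in>border B. in_kernel s M (border_poly B a c)" by blast
  next
    assume "\<exists>a. \<forall>c\<in>border B. in_kernel s M (border_poly B a c)"
    then obtain a where a: "\<And>c. c \<in> border B \<Longrightarrow> in_kernel s M (border_poly B a c)" by blast
    show "mat_rank ?C M \<le> card B"
    proof (rule mat_rank_le_card[OF fin(1)])
      fix c assume c: "c \<in> ?C"
      show "\<exists>u. \<forall>i\<in>?C. M i c = (\<Sum>k\<in>B. M i k * u k)"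
      proof (cases "c \<in> B")
        case True
        then have "\<forall>i\<in>?C. M i c = (\<Sum>k\<in>B. M i k * (if k = c then 1 else 0))"
          using fin(2) by (simp add: if_distrib[of "\<lambda>x. _ * x"] cong: if_cong)
        then show ?thesis by (intro exI[of _ "\<lambda>k. if k = c then 1 else 0"])
      next
        case False
        with c have "c \<in> border B" by blast
        with a[OF this] have "\<forall>i\<in>expos s. M i c = (\<Sum>b\<in>B. M i b * a b c)"
          using in_kernel_border_poly_iff[OF Bs] border by blast
        then show ?thesis
          using Bs border by (intro exI[of _ "\<lambda>b. a b c"]) blast
      qed
    qed simp
  qed
qed

text \<open>
  As the entry at the monomial \<open>1\<close> is a nonsingular submatrix of size one, \<open>B\<close> is not empty, and a
  nonempty order ideal contains \<open>1\<close>.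
\<close>

lemma one_in_max_nonsingular_order_ideal:
  assumes max: "max_nonsingular_principal (expos r) M B" and "order_ideal B" and M0: "M 0 0 \<noteq> 0"
  shows "0 \<in> B"
proof -
  have "nonsingular {0} M"
    unfolding nonsingular_iff_cols_independent[OF finite.insertI[OF finite.emptyI]]
    using M0 by (simp add: cols_independent_def)
  then have "card {0 :: 'a expo} \<le> card B"
    using max zero_in_expos[of r] unfolding max_nonsingular_principal_def by blast
  then have "B \<noteq> {}" by auto
  then obtain b where "b \<in> B" by blast
  then show ?thesis
    using \<open>order_ideal B\<close> unfolding order_ideal_def by (metis add.left_neutral)
qed

text \<open>
  The only link between \<open>M\<close> and the set \<open>V\<close> is that kernel polynomials vanish on \<open>V\<close>. It puts the
  border polynomials into the vanishing ideal of \<open>V\<close>; what remains is the algebra of border bases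
  and the count of zeros, with \<open>\<bar>B\<bar>\<close> in the role of the rank.
\<close>

lemma border_basis_of_kernel:
  fixes M :: "'n::finite expo \<Rightarrow> 'n expo \<Rightarrow> 'k" and V :: "(complex ^ 'n) set"
    and a :: "'n expo \<Rightarrow> 'n expo \<Rightarrow> 'k" and B :: "'n expo set"
  defines "G \<equiv> border_poly B a ` border B"
  defines "J \<equiv> ideal_gen G"
  defines "W \<equiv> complex_variety \<iota> J"
  assumes st: "s \<le> t" and psd: "psd (expos t) M" and M0: "M 0 0 \<noteq> 0"
    and V: "\<And>f v. in_kernel t M f \<Longrightarrow> v \<in> V \<Longrightarrow> mpoly_eval \<iota> f v = 0"
    and max: "max_nonsingular_principal (expos (s - 1)) M B" and order: "order_ideal B"
    and ker: "\<forall>c\<in>border B. in_kernel s M (border_poly B a c)"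
    and comm: "\<forall>k l. mat_eq B (mat_mult B (formal_mult B a k) (formal_mult B a l))
                        (mat_mult B (formal_mult B a l) (formal_mult B a k))"
  shows "border_basis B G J \<and> J \<subseteq> vanishing_ideal \<iota> V \<and> quotient_basis J B \<and> V \<subseteq> W \<and>
    finite W \<and> card W \<le> mat_rank (expos (s - 1)) M \<and>
    (card V = card W \<and> card W = mat_rank (expos (s - 1)) M \<longrightarrow>
      V = W \<and> vanishing_ideal \<iota> V = J \<and> border_basis B G (vanishing_ideal \<iota> V))"
proof -
  have finB: "finite B"
    using max finite_subset[OF _ finite_expos] unfolding max_nonsingular_principal_def by blast
  have "psd (expos (s - 1)) M"
    by (rule psd_complex_subset[OF psd expos_mono finite_expos]) (use st in simp)
  from card_max_nonsingular_principal[OF finite_expos this max]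
  have rank: "mat_rank (expos (s - 1)) M = card B" by simp
  have zero: "0 \<in> B" by (rule one_in_max_nonsingular_order_ideal[OF max order M0])
  have indep: "quotient_independent J B"
    unfolding J_def G_def by (rule commuting_imp_quotient_independent[OF finB order zero comm])
  have span: "\<exists>u. f - comb B u \<in> J" for f
    unfolding J_def G_def by (rule border_quotient_spanning[OF finB zero])
  have basis: "border_basis B G J"
    unfolding border_basis_def border_prebasis_def
    using order indep is_ideal_ideal_gen ideal_gen_superset G_def J_def by blast
  have vanish: "mpoly_eval \<iota> f v = 0" if "f \<in> J" "v \<in> V" for f v
    using that(1) unfolding J_def
    by (rule mpoly_eval_ideal_gen)
      (use V[OF in_kernel_extend[OF psd st] that(2)] ker in \<open>auto simp: G_def\<close>)
  have JV: "J \<subseteq> vanishing_ideal \<iota> V" and VW: "V \<subseteq> W"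
    using vanish by (auto simp: vanishing_ideal_def W_def complex_variety_def)
  have W: "finite W" "card W \<le> card B"
    using card_zeros_le[OF finB span] unfolding W_def by blast+
  have "V = W \<and> vanishing_ideal \<iota> V = J"
    if "card V = card W \<and> card W = mat_rank (expos (s - 1)) M"
    using card_subset_eq[OF W(1) VW] vanishing_ideal_of_zeros[OF finB span] that
    unfolding rank W_def by metis
  with basis indep span JV VW W show ?thesis
    unfolding rank quotient_basis_def by auto
qed

end

section \<open>Point evaluations and kernels of maximal rank\<close>

lemma half_deg_bounds:
  assumes "max_half_deg h m \<le> t" "j \<in> {1..m}"
  shows "half_deg (h j) \<le> t" "mdegree (h j) \<le> 2 * half_deg (h j)"
proof -
  have "half_deg (h j) \<le> max_half_deg h m"
    unfolding max_half_deg_def by (rule Max_ge) (use assms(2) in auto)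
  then show "half_deg (h j) \<le> t" using assms(1) by simp
  have "real (mdegree (h j)) / 2 \<le> real (half_deg (h j))"
    unfolding half_deg_def by linarith
  then show "mdegree (h j) \<le> 2 * half_deg (h j)" by linarith
qed

lemma generator_vanishes:
  assumes "v \<in> complex_variety \<iota> (ideal_gen (h ` {1..m}))" "j \<in> {1..m}"
  shows "mpoly_eval \<iota> (h j) v = 0"
  using assms ideal_gen_superset[of "h j" "h ` {1..m}"] unfolding complex_variety_def by blast

lemma shifted_expos:
  assumes "half_deg h \<le> t" "mdegree h \<le> 2 * half_deg h"
    "\<alpha> \<in> expos (t - half_deg h)" "\<beta> \<in> expos (t - half_deg h)" "\<gamma> \<in> Poly_Mapping.keys h"
  shows "expo_deg \<alpha> + (expo_deg \<beta> + expo_deg \<gamma>) \<le> 2 * t"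
  using assms expo_deg_le_mdegree[OF assms(5)] by (simp add: expos_def)

text \<open>
  The restriction keeps the midpoint of two vectors indexed by \<open>D\<close> a vector indexed by \<open>D\<close>.
\<close>

definition midpoint_on :: "'a set \<Rightarrow> ('a \<Rightarrow> 'k::field) \<Rightarrow> ('a \<Rightarrow> 'k) \<Rightarrow> 'a \<Rightarrow> 'k" where
  "midpoint_on D y z = restrict (\<lambda>\<alpha>. (y \<alpha> + z \<alpha>) / 2) D"

subsection \<open>The real case\<close>

interpretation real_coeff: complex_coeff complex_of_real
  by unfold_locales auto

definition real_evaluation :: "nat \<Rightarrow> complex ^ 'n::finite \<Rightarrow> 'n expo \<Rightarrow> real" where
  "real_evaluation t v = restrict (\<lambda>\<alpha>. Re (expo_eval v \<alpha>)) (expos (2 * t))"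

lemma expo_eval_real:
  assumes "v \<in> real_points"
  shows "expo_eval v \<alpha> = complex_of_real (Re (expo_eval v \<alpha>))"
proof -
  have "expo_eval v \<alpha> \<in> \<real>"
    unfolding expo_eval_def
    by (intro prod_in_Reals Reals_power) (use assms in \<open>auto simp: real_points_def\<close>)
  then show ?thesis by (simp add: complex_is_Real_iff complex_eq_iff)
qed

text \<open>
  The moment matrix of a point evaluation is the rank one matrix \<open>e e\<^sup>T\<close> of the vector \<open>e\<close> of the
  values of the monomials, and shifting by \<open>h\<close> multiplies it by the value of \<open>h\<close> at the point.
\<close>

lemma real_evaluation_in_K_real:
  fixes h :: "nat \<Rightarrow> ('n::finite, real) mpoly" and v :: "complex ^ 'n"
  assumes d: "max_half_deg h m \<le> t"
    and v: "v \<in> complex_variety complex_of_real (ideal_gen (h ` {1..m})) \<inter> real_points"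
  shows "real_evaluation t v \<in> K_real h m t"
proof -
  define e where "e \<alpha> = Re (expo_eval v \<alpha>)" for \<alpha>
  have e_add: "e (\<alpha> + \<beta>) = e \<alpha> * e \<beta>" for \<alpha> \<beta>
    using expo_eval_add[of v \<alpha> \<beta>] expo_eval_real[of v \<alpha>] expo_eval_real[of v \<beta>] v
    unfolding e_def by (metis IntD2 Re_complex_of_real of_real_mult)
  have z: "real_evaluation t v \<alpha> = e \<alpha>" if "expo_deg \<alpha> \<le> 2 * t" for \<alpha>
    using that by (simp add: real_evaluation_def e_def expos_def)
  have M: "moment_real (real_evaluation t v) \<alpha> \<beta> = e \<alpha> * e \<beta>"
    if "\<alpha> \<in> expos t" "\<beta> \<in> expos t" for \<alpha> \<beta>
    using that by (simp add: moment_real_def z expos_def expo_deg_add e_add)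
  have "psd_real (expos t) (moment_real (real_evaluation t v))"
    unfolding psd_real_def
  proof (intro conjI ballI allI)
    fix w :: "_ \<Rightarrow> real"
    have "(\<Sum>i\<in>expos t. \<Sum>j\<in>expos t. w i * moment_real (real_evaluation t v) i j * w j)
        = (\<Sum>i\<in>expos t. \<Sum>j\<in>expos t. (w i * e i) * (w j * e j))"
      by (intro sum.cong refl) (simp add: M)
    also have "\<dots> = (\<Sum>i\<in>expos t. w i * e i)^2"
      by (simp add: power2_eq_square sum_product)
    finally show "0 \<le> (\<Sum>i\<in>expos t. \<Sum>j\<in>expos t. w i * moment_real (real_evaluation t v) i j * w j)"
      by simp
  qed (simp add: M)
  moreover have "mat_eq (expos (t - half_deg (h j)))
      (moment_real (shift_real (h j) (real_evaluation t v))) (\<lambda>_ _. 0)" if j: "j \<in> {1..m}" for j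
    unfolding mat_eq_def
  proof (intro ballI)
    fix \<alpha> \<beta> :: "'n expo" assume ab: "\<alpha> \<in> expos (t - half_deg (h j))" "\<beta> \<in> expos (t - half_deg (h j))"
    have "mpoly_eval complex_of_real (h j) v = 0"
      using generator_vanishes[OF _ j] v by blast
    also have "mpoly_eval complex_of_real (h j) v =
        complex_of_real (\<Sum>\<gamma>\<in>Poly_Mapping.keys (h j). Poly_Mapping.lookup (h j) \<gamma> * e \<gamma>)"
      unfolding mpoly_eval_eq_lin_ext lin_ext_def e_def of_real_sum of_real_mult
      using expo_eval_real[of v] v by auto
    finally have h0: "(\<Sum>\<gamma>\<in>Poly_Mapping.keys (h j). Poly_Mapping.lookup (h j) \<gamma> * e \<gamma>) = 0"
      by (simp only: of_real_eq_0_iff)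
    have "moment_real (shift_real (h j) (real_evaluation t v)) \<alpha> \<beta> =
        (\<Sum>\<gamma>\<in>Poly_Mapping.keys (h j). Poly_Mapping.lookup (h j) \<gamma> * e (\<alpha> + \<beta> + \<gamma>))"
      unfolding moment_real_def shift_real_def
      by (intro sum.cong refl)
        (use shifted_expos[OF half_deg_bounds[OF d j] ab] in \<open>simp add: z expo_deg_add add.assoc\<close>)
    also have "\<dots> = e (\<alpha> + \<beta>) * (\<Sum>\<gamma>\<in>Poly_Mapping.keys (h j). Poly_Mapping.lookup (h j) \<gamma> * e \<gamma>)"
      unfolding sum_distrib_left by (intro sum.cong refl) (simp add: e_add)
    finally show "moment_real (shift_real (h j) (real_evaluation t v)) \<alpha> \<beta> = 0"
      by (simp add: h0)
  qed
  moreover have "real_evaluation t v 0 = 1"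
    by (simp add: z e_def)
  ultimately show ?thesis
    by (simp add: K_real_def real_evaluation_def)
qed

lemma midpoint_in_K_real:
  fixes h :: "nat \<Rightarrow> ('n::finite, real) mpoly"
  assumes d: "max_half_deg h m \<le> t" and y: "y \<in> K_real h m t" and z: "z \<in> K_real h m t"
  shows "midpoint_on (expos (2 * t)) y z \<in> K_real h m t"
proof -
  define q where "q = midpoint_on (expos (2 * t)) y z"
  have q: "q \<alpha> = (y \<alpha> + z \<alpha>) / 2" if "expo_deg \<alpha> \<le> 2 * t" for \<alpha>
    using that by (simp add: q_def midpoint_on_def expos_def)
  have psd: "psd_real (expos t) (moment_real y)" "psd_real (expos t) (moment_real z)"
    using y z by (auto simp: K_real_def)
  have "psd_real (expos t) (moment_real q)"
    unfolding psd_real_def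
  proof (intro conjI ballI allI)
    fix u :: "_ \<Rightarrow> real"
    have "(\<Sum>i\<in>expos t. \<Sum>j\<in>expos t. u i * moment_real q i j * u j)
        = (\<Sum>i\<in>expos t. \<Sum>j\<in>expos t. (u i * moment_real y i j * u j + u i * moment_real z i j * u j) / 2)"
      by (intro sum.cong refl) (simp add: moment_real_def q expos_def expo_deg_add distrib_left distrib_right)
    also have "\<dots> = ((\<Sum>i\<in>expos t. \<Sum>j\<in>expos t. u i * moment_real y i j * u j) +
        (\<Sum>i\<in>expos t. \<Sum>j\<in>expos t. u i * moment_real z i j * u j)) / 2"
      by (simp only: sum.distrib flip: sum_divide_distrib)
    also have "0 \<le> \<dots>"
      using psd unfolding psd_real_def by simp
    finally show "0 \<le> (\<Sum>i\<in>expos t. \<Sum>j\<in>expos t. u i * moment_real q i j * u j)" .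
  qed (simp add: moment_real_def add.commute)
  moreover have "mat_eq (expos (t - half_deg (h j))) (moment_real (shift_real (h j) q)) (\<lambda>_ _. 0)"
    if j: "j \<in> {1..m}" for j
    unfolding mat_eq_def
  proof (intro ballI)
    fix \<alpha> \<beta> :: "'n expo" assume ab: "\<alpha> \<in> expos (t - half_deg (h j))" "\<beta> \<in> expos (t - half_deg (h j))"
    have "moment_real (shift_real (h j) q) \<alpha> \<beta> = (\<Sum>\<gamma>\<in>Poly_Mapping.keys (h j).
        (Poly_Mapping.lookup (h j) \<gamma> * y (\<alpha> + \<beta> + \<gamma>) + Poly_Mapping.lookup (h j) \<gamma> * z (\<alpha> + \<beta> + \<gamma>)) / 2)"
      unfolding moment_real_def shift_real_def
      by (intro sum.cong refl)
        (use shifted_expos[OF half_deg_bounds[OF d j] ab] in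
          \<open>simp add: q expo_deg_add add.assoc distrib_left\<close>)
    also have "\<dots> = (moment_real (shift_real (h j) y) \<alpha> \<beta> + moment_real (shift_real (h j) z) \<alpha> \<beta>) / 2"
      by (simp only: moment_real_def shift_real_def sum.distrib flip: sum_divide_distrib)
    also have "\<dots> = 0"
      using y z j ab by (simp add: K_real_def mat_eq_def)
    finally show "moment_real (shift_real (h j) q) \<alpha> \<beta> = 0" .
  qed
  moreover have "q 0 = 1"
    using y z by (simp add: q K_real_def)
  ultimately show ?thesis
    by (simp add: K_real_def q_def midpoint_on_def)
qed

text \<open>
  The feasible set is convex, so the midpoint of \<open>y\<close> and the evaluation at \<open>v\<close> cannot exceed the
  maximal rank, and the kernel at \<open>y\<close> is contained in the kernel at the evaluation. The row of
  the monomial \<open>1\<close> in the latter says that the polynomial vanishes at \<open>v\<close>.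
\<close>

lemma max_rank_kernel_vanishes_real:
  assumes d: "max_half_deg h m \<le> t" and y: "y \<in> K_real h m t"
    and max: "\<forall>z\<in>K_real h m t. mat_rank (expos t) (moment_real z) \<le> mat_rank (expos t) (moment_real y)"
    and v: "v \<in> complex_variety complex_of_real (ideal_gen (h ` {1..m})) \<inter> real_points"
    and f: "in_kernel t (moment_real y) f"
  shows "mpoly_eval complex_of_real f v = 0"
proof -
  let ?z = "real_evaluation t v" and ?w = "midpoint_on (expos (2 * t)) y (real_evaluation t v)"
  have z: "?z \<in> K_real h m t" by (rule real_evaluation_in_K_real[OF d v])
  have "(\<Sum>\<beta>\<in>expos t. moment_real ?z 0 \<beta> * Poly_Mapping.lookup f \<beta>) = 0"
  proof (rule real_coeff.max_rank_kernel_minimal[where M = "moment_real y" and N = "moment_real ?w"])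
    show "real_coeff.psd (expos t) (moment_real y)" "real_coeff.psd (expos t) (moment_real ?z)"
      using y z by (auto intro!: psd_complex_of_real simp: K_real_def)
    show "mat_rank (expos t) (moment_real ?w) \<le> mat_rank (expos t) (moment_real y)"
      using max midpoint_in_K_real[OF d y z] by blast
    show "2 * moment_real ?w i j = moment_real y i j + moment_real ?z i j"
      if "i \<in> expos t" "j \<in> expos t" for i j
      using that by (simp add: moment_real_def midpoint_on_def expos_def expo_deg_add)
  qed (use f in \<open>auto simp: in_kernel_def\<close>)
  moreover have "moment_real ?z 0 \<beta> = Re (expo_eval v \<beta>)" if "\<beta> \<in> expos t" for \<beta>
    using that by (simp add: moment_real_def real_evaluation_def expos_def)
  ultimately have "(\<Sum>\<beta>\<in>expos t. Poly_Mapping.lookup f \<beta> * Re (expo_eval v \<beta>)) = 0"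
    by (simp add: mult.commute)
  moreover have "mpoly_eval complex_of_real f v =
      (\<Sum>\<beta>\<in>expos t. complex_of_real (Poly_Mapping.lookup f \<beta>) * expo_eval v \<beta>)"
    unfolding mpoly_eval_eq_lin_ext
    by (rule real_coeff.lin_ext_eq_sum) (use f in \<open>auto simp: in_kernel_def mdegree_le_iff\<close>)
  moreover have "\<dots> = complex_of_real (\<Sum>\<beta>\<in>expos t. Poly_Mapping.lookup f \<beta> * Re (expo_eval v \<beta>))"
    unfolding of_real_sum of_real_mult using expo_eval_real[of v] v by auto
  ultimately show ?thesis by simp
qed

subsection \<open>The complex case\<close>

interpretation id_coeff: complex_coeff "id :: complex \<Rightarrow> complex"
  by unfold_locales auto

definition complex_evaluation ::
    "nat \<Rightarrow> complex ^ 'n::finite \<Rightarrow> 'n expo \<times> 'n expo \<Rightarrow> complex" where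
  "complex_evaluation t v =
    restrict (\<lambda>(\<alpha>, \<alpha>'). cnj (expo_eval v \<alpha>) * expo_eval v \<alpha>') (expo_pairs (2 * t))"

text \<open>
  Now the rank one matrix is the Hermitian one whose row \<open>\<alpha>\<close> and column \<open>\<beta>\<close> hold the product of the
  conjugate of \<open>v^\<alpha>\<close> with \<open>v^\<beta>\<close>. The shift by \<open>h\<close> acts on the unconjugated factor, so that it
  multiplies by the value of \<open>h\<close> itself.
\<close>

lemma complex_evaluation_in_K_complex:
  fixes h :: "nat \<Rightarrow> ('n::finite, complex) mpoly" and v :: "complex ^ 'n"
  assumes d: "max_half_deg h m \<le> t"
    and v: "v \<in> complex_variety id (ideal_gen (h ` {1..m}))"
  shows "complex_evaluation t v \<in> K_complex h m t"
proof -
  define e where "e = expo_eval v"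
  have z: "complex_evaluation t v (\<alpha>, \<beta>) = cnj (e \<alpha>) * e \<beta>" if "expo_deg \<alpha> + expo_deg \<beta> \<le> 2 * t" for \<alpha> \<beta>
    using that by (simp add: complex_evaluation_def e_def expo_pairs_def)
  have M: "moment_complex (complex_evaluation t v) \<alpha> \<beta> = cnj (e \<alpha>) * e \<beta>"
    if "\<alpha> \<in> expos t" "\<beta> \<in> expos t" for \<alpha> \<beta>
    using that by (simp add: moment_complex_def z expos_def)
  have "psd_complex (expos t) (moment_complex (complex_evaluation t v))"
    unfolding psd_complex_def
  proof (intro conjI ballI allI)
    fix w :: "_ \<Rightarrow> complex"
    have "(\<Sum>i\<in>expos t. \<Sum>j\<in>expos t. cnj (w i) * moment_complex (complex_evaluation t v) i j * w j)
        = (\<Sum>i\<in>expos t. \<Sum>j\<in>expos t. cnj (w i * e i) * (w j * e j))"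
      by (intro sum.cong refl) (simp add: M)
    also have "\<dots> = cnj (\<Sum>i\<in>expos t. w i * e i) * (\<Sum>i\<in>expos t. w i * e i)"
      unfolding sum_product cnj_sum ..
    also have "\<dots> = of_real ((cmod (\<Sum>i\<in>expos t. w i * e i))^2)"
      unfolding complex_norm_square by (rule mult.commute)
    finally show "0 \<le> Re (\<Sum>i\<in>expos t. \<Sum>j\<in>expos t. cnj (w i) * moment_complex (complex_evaluation t v) i j * w j)"
      by (simp only: Re_complex_of_real zero_le_power2)
  qed (simp add: M)
  moreover have "mat_eq (expos (t - half_deg (h j)))
      (moment_complex (shift_complex (h j) (complex_evaluation t v))) (\<lambda>_ _. 0)" if j: "j \<in> {1..m}" for j
    unfolding mat_eq_def
  proof (intro ballI)
    fix \<alpha> \<beta> :: "'n expo" assume ab: "\<alpha> \<in> expos (t - half_deg (h j))" "\<beta> \<in> expos (t - half_deg (h j))"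
    have h0: "(\<Sum>\<gamma>\<in>Poly_Mapping.keys (h j). Poly_Mapping.lookup (h j) \<gamma> * e \<gamma>) = 0"
      using generator_vanishes[OF v j] by (simp add: mpoly_eval_eq_lin_ext lin_ext_def e_def)
    have "moment_complex (shift_complex (h j) (complex_evaluation t v)) \<alpha> \<beta> =
        (\<Sum>\<gamma>\<in>Poly_Mapping.keys (h j). Poly_Mapping.lookup (h j) \<gamma> * (cnj (e \<beta>) * e (\<alpha> + \<gamma>)))"
      unfolding moment_complex_def shift_complex_def prod.case
      by (intro sum.cong refl)
        (use shifted_expos[OF half_deg_bounds[OF d j] ab(2,1)] in \<open>simp add: z expo_deg_add\<close>)
    also have "\<dots> = cnj (e \<beta>) * e \<alpha> * (\<Sum>\<gamma>\<in>Poly_Mapping.keys (h j). Poly_Mapping.lookup (h j) \<gamma> * e \<gamma>)"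
      unfolding sum_distrib_left by (intro sum.cong refl) (simp add: e_def expo_eval_add)
    finally show "moment_complex (shift_complex (h j) (complex_evaluation t v)) \<alpha> \<beta> = 0"
      by (simp add: h0)
  qed
  moreover have "complex_evaluation t v (0, 0) = 1"
    by (simp add: z e_def)
  moreover have "\<forall>(\<alpha>, \<alpha>')\<in>expo_pairs (2 * t).
      complex_evaluation t v (\<alpha>', \<alpha>) = cnj (complex_evaluation t v (\<alpha>, \<alpha>'))"
    by (auto simp: expo_pairs_def z add.commute)
  ultimately show ?thesis
    by (simp add: K_complex_def complex_evaluation_def)
qed

lemma midpoint_in_K_complex:
  fixes h :: "nat \<Rightarrow> ('n::finite, complex) mpoly"
  assumes d: "max_half_deg h m \<le> t" and y: "y \<in> K_complex h m t" and z: "z \<in> K_complex h m t"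
  shows "midpoint_on (expo_pairs (2 * t)) y z \<in> K_complex h m t"
proof -
  define q where "q = midpoint_on (expo_pairs (2 * t)) y z"
  have q: "q (\<alpha>, \<beta>) = (y (\<alpha>, \<beta>) + z (\<alpha>, \<beta>)) / 2" if "expo_deg \<alpha> + expo_deg \<beta> \<le> 2 * t" for \<alpha> \<beta>
    using that by (simp add: q_def midpoint_on_def expo_pairs_def)
  have herm: "\<forall>(\<alpha>, \<alpha>')\<in>expo_pairs (2 * t). q (\<alpha>', \<alpha>) = cnj (q (\<alpha>, \<alpha>'))"
  proof (clarify)
    fix \<alpha> \<alpha>' :: "'n expo" assume a: "(\<alpha>, \<alpha>') \<in> expo_pairs (2 * t)"
    have "y (\<alpha>', \<alpha>) = cnj (y (\<alpha>, \<alpha>'))" "z (\<alpha>', \<alpha>) = cnj (z (\<alpha>, \<alpha>'))"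
      using y z a unfolding K_complex_def by blast+
    moreover have "q (\<alpha>', \<alpha>) = (y (\<alpha>', \<alpha>) + z (\<alpha>', \<alpha>)) / 2" "q (\<alpha>, \<alpha>') = (y (\<alpha>, \<alpha>') + z (\<alpha>, \<alpha>')) / 2"
      using a q[of \<alpha>' \<alpha>] q[of \<alpha> \<alpha>'] by (simp_all add: expo_pairs_def add.commute)
    ultimately show "q (\<alpha>', \<alpha>) = cnj (q (\<alpha>, \<alpha>'))"
      by (simp only: complex_cnj_divide complex_cnj_add complex_cnj_numeral)
  qed
  have psd: "psd_complex (expos t) (moment_complex y)" "psd_complex (expos t) (moment_complex z)"
    using y z by (auto simp: K_complex_def)
  have "psd_complex (expos t) (moment_complex q)"
    unfolding psd_complex_def
  proof (intro conjI ballI allI)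
    fix i j :: "'n expo" assume "i \<in> expos t" "j \<in> expos t"
    then have "(i, j) \<in> expo_pairs (2 * t)" by (simp add: expos_def expo_pairs_def)
    with herm show "moment_complex q j i = cnj (moment_complex q i j)"
      unfolding moment_complex_def by blast
  next
    fix u :: "_ \<Rightarrow> complex"
    have "(\<Sum>i\<in>expos t. \<Sum>j\<in>expos t. cnj (u i) * moment_complex q i j * u j)
        = (\<Sum>i\<in>expos t. \<Sum>j\<in>expos t.
            (cnj (u i) * moment_complex y i j * u j + cnj (u i) * moment_complex z i j * u j) / 2)"
      by (intro sum.cong refl) (simp add: moment_complex_def q expos_def distrib_left distrib_right)
    also have "\<dots> = ((\<Sum>i\<in>expos t. \<Sum>j\<in>expos t. cnj (u i) * moment_complex y i j * u j) +
        (\<Sum>i\<in>expos t. \<Sum>j\<in>expos t. cnj (u i) * moment_complex z i j * u j)) / 2"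
      by (simp only: sum.distrib flip: sum_divide_distrib)
    finally have eq: "(\<Sum>i\<in>expos t. \<Sum>j\<in>expos t. cnj (u i) * moment_complex q i j * u j) = \<dots>" .
    have "0 \<le> Re (\<Sum>i\<in>expos t. \<Sum>j\<in>expos t. cnj (u i) * moment_complex y i j * u j)"
      "0 \<le> Re (\<Sum>i\<in>expos t. \<Sum>j\<in>expos t. cnj (u i) * moment_complex z i j * u j)"
      using psd unfolding psd_complex_def by blast+
    then show "0 \<le> Re (\<Sum>i\<in>expos t. \<Sum>j\<in>expos t. cnj (u i) * moment_complex q i j * u j)"
      unfolding eq Re_divide_numeral plus_complex.sel by (intro divide_nonneg_nonneg add_nonneg_nonneg) auto
  qed
  moreover have "mat_eq (expos (t - half_deg (h j))) (moment_complex (shift_complex (h j) q)) (\<lambda>_ _. 0)"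
    if j: "j \<in> {1..m}" for j
    unfolding mat_eq_def
  proof (intro ballI)
    fix \<alpha> \<beta> :: "'n expo" assume ab: "\<alpha> \<in> expos (t - half_deg (h j))" "\<beta> \<in> expos (t - half_deg (h j))"
    have "moment_complex (shift_complex (h j) q) \<alpha> \<beta> = (\<Sum>\<gamma>\<in>Poly_Mapping.keys (h j).
        (Poly_Mapping.lookup (h j) \<gamma> * y (\<beta>, \<alpha> + \<gamma>) + Poly_Mapping.lookup (h j) \<gamma> * z (\<beta>, \<alpha> + \<gamma>)) / 2)"
      unfolding moment_complex_def shift_complex_def prod.case
      by (intro sum.cong refl)
        (use shifted_expos[OF half_deg_bounds[OF d j] ab(2,1)] in
          \<open>simp add: q expo_deg_add distrib_left\<close>)
    also have "\<dots> = (moment_complex (shift_complex (h j) y) \<alpha> \<beta> + moment_complex (shift_complex (h j) z) \<alpha> \<beta>) / 2"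
      by (simp only: moment_complex_def shift_complex_def prod.case sum.distrib flip: sum_divide_distrib)
    also have "\<dots> = 0"
      using y z j ab by (simp add: K_complex_def mat_eq_def)
    finally show "moment_complex (shift_complex (h j) q) \<alpha> \<beta> = 0" .
  qed
  moreover have "q (0, 0) = 1"
    using y z by (simp add: q K_complex_def)
  ultimately show ?thesis
    using herm by (simp add: K_complex_def q_def midpoint_on_def)
qed

lemma max_rank_kernel_vanishes_complex:
  assumes d: "max_half_deg h m \<le> t" and y: "y \<in> K_complex h m t"
    and max: "\<forall>z\<in>K_complex h m t.
      mat_rank (expos t) (moment_complex z) \<le> mat_rank (expos t) (moment_complex y)"
    and v: "v \<in> complex_variety id (ideal_gen (h ` {1..m}))"
    and f: "in_kernel t (moment_complex y) f"
  shows "mpoly_eval id f v = 0"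
proof -
  let ?z = "complex_evaluation t v" and ?w = "midpoint_on (expo_pairs (2 * t)) y (complex_evaluation t v)"
  have z: "?z \<in> K_complex h m t" by (rule complex_evaluation_in_K_complex[OF d v])
  have "(\<Sum>\<beta>\<in>expos t. moment_complex ?z 0 \<beta> * Poly_Mapping.lookup f \<beta>) = 0"
  proof (rule id_coeff.max_rank_kernel_minimal[where M = "moment_complex y" and N = "moment_complex ?w"])
    show "id_coeff.psd (expos t) (moment_complex y)" "id_coeff.psd (expos t) (moment_complex ?z)"
      using y z by (auto simp: K_complex_def)
    show "mat_rank (expos t) (moment_complex ?w) \<le> mat_rank (expos t) (moment_complex y)"
      using max midpoint_in_K_complex[OF d y z] by blast
    show "2 * moment_complex ?w i j = moment_complex y i j + moment_complex ?z i j"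
      if "i \<in> expos t" "j \<in> expos t" for i j
      using that by (simp add: moment_complex_def midpoint_on_def expos_def expo_pairs_def)
  qed (use f in \<open>auto simp: in_kernel_def\<close>)
  moreover have "moment_complex ?z 0 \<beta> = expo_eval v \<beta>" if "\<beta> \<in> expos t" for \<beta>
    using that by (simp add: moment_complex_def complex_evaluation_def expos_def expo_pairs_def)
  ultimately have "(\<Sum>\<beta>\<in>expos t. Poly_Mapping.lookup f \<beta> * expo_eval v \<beta>) = 0"
    by (simp add: mult.commute)
  moreover have "mpoly_eval id f v = (\<Sum>\<beta>\<in>expos t. id (Poly_Mapping.lookup f \<beta>) * expo_eval v \<beta>)"
    unfolding mpoly_eval_eq_lin_ext
    by (rule id_coeff.lin_ext_eq_sum) (use f in \<open>auto simp: in_kernel_def mdegree_le_iff\<close>)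
  ultimately show ?thesis by simp
qed

theorem proposition4p1:
  shows
    "(\<forall>(h :: nat \<Rightarrow> ('n::finite, real) mpoly) m t s (y :: 'n expo \<Rightarrow> real)
         (B :: 'n expo set).
       let M = moment_real y;
           I = ideal_gen (h ` {1..m});
           V = complex_variety complex_of_real I \<inter> real_points
       in
         max_half_deg h m \<le> t \<and> 1 \<le> s \<and> s \<le> t \<and>
         y \<in> K_real h m t \<and>
         (\<forall>z\<in>K_real h m t. mat_rank (expos t) (moment_real z) \<le> mat_rank (expos t) M) \<and>
         max_nonsingular_principal (expos (s - 1)) M B \<and>
         order_ideal B
         \<longrightarrow>
         (mat_rank (B \<union> border B) M = mat_rank (expos (s - 1)) M \<longleftrightarrow>
            (\<exists>a. \<forall>c\<in>border B. in_kernel s M (border_poly B a c))) \<and>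
         (\<forall>a :: 'n expo \<Rightarrow> 'n expo \<Rightarrow> real.
          let G = border_poly B a ` border B;
              J = ideal_gen G;
              W = complex_variety complex_of_real J
          in
            mat_rank (B \<union> border B) M = mat_rank (expos (s - 1)) M \<and>
            (\<forall>c\<in>border B. in_kernel s M (border_poly B a c)) \<and>
            (\<forall>k l. mat_eq B (mat_mult B (formal_mult B a k) (formal_mult B a l))
                            (mat_mult B (formal_mult B a l) (formal_mult B a k)))
            \<longrightarrow>
            border_basis B G J \<and>
            J \<subseteq> vanishing_ideal complex_of_real V \<and>
            quotient_basis J B \<and>
            V \<subseteq> W \<and>
            finite W \<and> card W \<le> mat_rank (expos (s - 1)) M \<and>
            (card V = card W \<and> card W = mat_rank (expos (s - 1)) M \<longrightarrow>
               V = W \<and> vanishing_ideal complex_of_real V = J \<and> border_basis B G (vanishing_ideal complex_of_real V))))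
     \<and>
     (\<forall>(h :: nat \<Rightarrow> ('n::finite, complex) mpoly) m t s (y :: 'n expo \<times> 'n expo \<Rightarrow> complex)
         (B :: 'n expo set).
       let M = moment_complex y;
           I = ideal_gen (h ` {1..m});
           V = complex_variety id I
       in
         max_half_deg h m \<le> t \<and> 1 \<le> s \<and> s \<le> t \<and>
         y \<in> K_complex h m t \<and>
         (\<forall>z\<in>K_complex h m t. mat_rank (expos t) (moment_complex z) \<le> mat_rank (expos t) M) \<and>
         max_nonsingular_principal (expos (s - 1)) M B \<and>
         order_ideal B
         \<longrightarrow>
         (mat_rank (B \<union> border B) M = mat_rank (expos (s - 1)) M \<longleftrightarrow>
            (\<exists>a. \<forall>c\<in>border B. in_kernel s M (border_poly B a c))) \<and>
         (\<forall>a :: 'n expo \<Rightarrow> 'n expo \<Rightarrow> complex.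
          let G = border_poly B a ` border B;
              J = ideal_gen G;
              W = complex_variety id J
          in
            mat_rank (B \<union> border B) M = mat_rank (expos (s - 1)) M \<and>
            (\<forall>c\<in>border B. in_kernel s M (border_poly B a c)) \<and>
            (\<forall>k l. mat_eq B (mat_mult B (formal_mult B a k) (formal_mult B a l))
                            (mat_mult B (formal_mult B a l) (formal_mult B a k)))
            \<longrightarrow>
            border_basis B G J \<and>
            J \<subseteq> vanishing_ideal id V \<and>
            quotient_basis J B \<and>
            V \<subseteq> W \<and>
            finite W \<and> card W \<le> mat_rank (expos (s - 1)) M \<and>
            (card V = card W \<and> card W = mat_rank (expos (s - 1)) M \<longrightarrow>
               V = W \<and> vanishing_ideal id V = J \<and> border_basis B G (vanishing_ideal id V))))"
  unfolding Let_def
proof ((rule conjI; intro allI impI), goal_cases)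
  case (1 h m t s y B)
  then have d: "max_half_deg h m \<le> t" and s: "1 \<le> s" "s \<le> t" and y: "y \<in> K_real h m t"
    and max: "\<forall>z\<in>K_real h m t.
      mat_rank (expos t) (moment_real z) \<le> mat_rank (expos t) (moment_real y)"
    and B: "max_nonsingular_principal (expos (s - 1)) (moment_real y) B" "order_ideal B"
    by blast+
  have psd: "real_coeff.psd (expos t) (moment_real y)"
    using y by (auto intro: psd_complex_of_real simp: K_real_def)
  have y0: "moment_real y 0 0 \<noteq> 0"
    using y by (simp add: K_real_def moment_real_def)
  show ?case
    using real_coeff.flat_iff_border_kernel[OF s(1) psd_complex_subset[OF psd expos_mono[OF s(2)] finite_expos] B(1)]
      real_coeff.border_basis_of_kernel[OF s(2) psd y0
        max_rank_kernel_vanishes_real[OF d y max] B]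
    by blast
next
  case (2 h m t s y B)
  then have d: "max_half_deg h m \<le> t" and s: "1 \<le> s" "s \<le> t" and y: "y \<in> K_complex h m t"
    and max: "\<forall>z\<in>K_complex h m t.
      mat_rank (expos t) (moment_complex z) \<le> mat_rank (expos t) (moment_complex y)"
    and B: "max_nonsingular_principal (expos (s - 1)) (moment_complex y) B" "order_ideal B"
    by blast+
  have psd: "id_coeff.psd (expos t) (moment_complex y)"
    using y by (simp add: K_complex_def)
  have y0: "moment_complex y 0 0 \<noteq> 0"
    using y by (simp add: K_complex_def moment_complex_def)
  show ?case
    using id_coeff.flat_iff_border_kernel[OF s(1) psd_complex_subset[OF psd expos_mono[OF s(2)] finite_expos] B(1)]
      id_coeff.border_basis_of_kernel[OF s(2) psd y0
        max_rank_kernel_vanishes_complex[OF d y max] B]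
    by blast
qed

end
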